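(* Let $n\ge1$ and $\omega\in\mathfrak S_n$. The pipe dream congruence $\equiv_\omega$ (the equivalence relation on $[e,\omega]$ whose equivalence classes are the sets $\mathcal L(P)$ for $P\in\mathrm{APD}(\omega)$) is a lattice congruence of the weak order interval $[e,\omega]$: if $x\equiv_\omega x'$ and $y\equiv_\omega y'$ then $x\wedge y\equiv_\omega x'\wedge y'$ and $x\vee y\equiv_\omega x'\vee y'$, where $\wedge,\vee$ are the meet and join of the lattice $[e,\omega]$.
   Context: Permutations of $[n]$ are written in one-line notation $\pi=\pi(1)\cdots\pi(n)$. An inversion of $\pi$ is a pair of values $i<j$ with $\pi^{-1}(i)>\pi^{-1}(j)$. The weak order on $\mathfrak S_n$: $\pi\le\sigma$ iff every inversion of $\pi$ is an inversion of $\sigma$; it is a lattice, and so is every interval $[e,\omega]$ ($e$ the identity). Pipe dreams: on the triangular shape of grid positions $(r,c)$ (row from top, column from left) with $r,c\ge1$, $r+c\le n+1$, each position with $r+c\le n$ is a crossing or a contact and each position with $r+c=n+1$ is an elbow, forming $n$ pipes; pipe $j$ enters from the left at row $j$, moves only east and north, and exits at the top. At a crossing the pipe from the west continues east and the one from the south continues north; at a contact the pipe from the west turns north (northwest pipe) and the pipe from the south turns east (southeast pipe). Two pipes cross at most once. $\mathrm{PD}(\omega)$: pipe dreams where pipe $j$ exits at column $\omega^{-1}(j)$ for all $j$. The contact graph $P^{\#}$ is the directed multigraph on $[n]$ with an arc from the northwest pipe to the southeast pipe of each contact; $P$ is acyclic if $P^{\#}$ has no directed cycle, and $\mathrm{APD}(\omega)$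 is the set of acyclic pipe dreams of $\mathrm{PD}(\omega)$. A linear extension of $P$ is a $\pi\in\mathfrak S_n$ with $\pi^{-1}(i)<\pi^{-1}(j)$ for every arc $i\to j$; $\mathcal L(P)$ is their set. It is known that the sets $\mathcal L(P)$, $P\in\mathrm{APD}(\omega)$, partition $[e,\omega]$, so $\equiv_\omega$ is a well-defined equivalence relation. *)

theory Defs
  imports
    "HOL-Combinatorics.Permutations"
    "HOL-Algebra.Lattice"
    "Graph_Theory.Digraph_Component"
begin

section \<open>Weak order\<close>

text \<open>
  A permutation of $[n]$ is a function \<open>\<pi>\<close> with \<^term>\<open>\<pi> permutes {1..n}\<close>; its one-line
  notation is \<open>\<pi> 1 \<dots> \<pi> n\<close>, so that \<open>inv \<pi> i\<close> is the position of the value \<open>i\<close>.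
\<close>

definition inversions :: "nat \<Rightarrow> (nat \<Rightarrow> nat) \<Rightarrow> (nat \<times> nat) set" where
  "inversions n \<pi> = {(i, j). i \<in> {1..n} \<and> j \<in> {1..n} \<and> i < j \<and> inv \<pi> i > inv \<pi> j}"

definition weak_le :: "nat \<Rightarrow> (nat \<Rightarrow> nat) \<Rightarrow> (nat \<Rightarrow> nat) \<Rightarrow> bool" where
  "weak_le n \<pi> \<sigma> \<longleftrightarrow> inversions n \<pi> \<subseteq> inversions n \<sigma>"

definition weak_interval :: "nat \<Rightarrow> (nat \<Rightarrow> nat) \<Rightarrow> (nat \<Rightarrow> nat) gorder" where
  "weak_interval n \<omega> =
    \<lparr>carrier = {\<pi>. \<pi> permutes {1..n} \<and> weak_le n id \<pi> \<and> weak_le n \<pi> \<omega>},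
     eq = (=), le = weak_le n\<rparr>"

definition lattice_congruence :: "('a, 'b) gorder_scheme \<Rightarrow> 'a rel \<Rightarrow> bool" where
  "lattice_congruence L R \<longleftrightarrow>
    lattice L \<and> equiv (carrier L) R \<and>
    (\<forall>x x' y y'. (x, x') \<in> R \<longrightarrow> (y, y') \<in> R \<longrightarrow>
      (x \<sqinter>\<^bsub>L\<^esub> y, x' \<sqinter>\<^bsub>L\<^esub> y') \<in> R \<and> (x \<squnion>\<^bsub>L\<^esub> y, x' \<squnion>\<^bsub>L\<^esub> y') \<in> R)"

section \<open>Pipe dreams\<close>

text \<open>
  A pipe dream is represented by the set \<open>P\<close> of its crossings, a subset of \<open>inner_cells n\<close>.
  The other cells of \<open>inner_cells n\<close> are contacts, and the cells \<open>(r, c)\<close> with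
  \<open>r + c = n + 1\<close> are elbows.
\<close>

definition inner_cells :: "nat \<Rightarrow> (nat \<times> nat) set" where
  "inner_cells n = {(r, c). 1 \<le> r \<and> 1 \<le> c \<and> r + c \<le> n}"

definition contacts :: "nat \<Rightarrow> (nat \<times> nat) set \<Rightarrow> (nat \<times> nat) set" where
  "contacts n P = inner_cells n - P"

datatype side = West | South

text \<open>
  \<open>enters P j (r, c) s\<close>: pipe \<open>j\<close> enters the cell \<open>(r, c)\<close> from its side \<open>s\<close>. Rows are
  numbered from the top, starting at \<open>1\<close>; entering \<open>(0, c)\<close> from the south means leaving
  the shape at the top of column \<open>c\<close>. An elbow is never in \<open>P\<close> and is only entered from
  the west, so the rule for the northwest pipe of a contact also covers the elbows.
\<close>

inductive enters :: "(nat \<times> nat) set \<Rightarrow> nat \<Rightarrow> nat \<times> nat \<Rightarrow> side \<Rightarrow> bool"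
  for P :: "(nat \<times> nat) set" and j :: nat where
  start: "enters P j (j, 1) West"
| cross_east: "\<lbrakk>enters P j (Suc r, c) West; (Suc r, c) \<in> P\<rbrakk> \<Longrightarrow> enters P j (Suc r, Suc c) West"
| cross_north: "\<lbrakk>enters P j (Suc r, c) South; (Suc r, c) \<in> P\<rbrakk> \<Longrightarrow> enters P j (r, c) South"
| turn_north: "\<lbrakk>enters P j (Suc r, c) West; (Suc r, c) \<notin> P\<rbrakk> \<Longrightarrow> enters P j (r, c) South"
| turn_east: "\<lbrakk>enters P j (Suc r, c) South; (Suc r, c) \<notin> P\<rbrakk> \<Longrightarrow> enters P j (Suc r, Suc c) West"

definition exits_at :: "(nat \<times> nat) set \<Rightarrow> nat \<Rightarrow> nat \<Rightarrow> bool" where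
  "exits_at P j c \<longleftrightarrow> enters P j (0, c) South"

definition pipes_cross_at :: "(nat \<times> nat) set \<Rightarrow> nat \<Rightarrow> nat \<Rightarrow> nat \<times> nat \<Rightarrow> bool" where
  "pipes_cross_at P i j p \<longleftrightarrow> p \<in> P \<and>
    (enters P i p West \<and> enters P j p South \<or> enters P i p South \<and> enters P j p West)"

definition pipe_dream :: "nat \<Rightarrow> (nat \<times> nat) set \<Rightarrow> bool" where
  "pipe_dream n P \<longleftrightarrow> P \<subseteq> inner_cells n \<and>
    (\<forall>i\<in>{1..n}. \<forall>j\<in>{1..n}. \<forall>p q. pipes_cross_at P i j p \<and> pipes_cross_at P i j q \<longrightarrow> p = q)"

definition PD :: "nat \<Rightarrow> (nat \<Rightarrow> nat) \<Rightarrow> (nat \<times> nat) set set" where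
  "PD n \<omega> = {P. pipe_dream n P \<and> (\<forall>j\<in>{1..n}. exits_at P j (inv \<omega> j))}"

text \<open>
  The arc of a contact \<open>p\<close> with northwest pipe \<open>i\<close> and southeast pipe \<open>j\<close> is the triple
  \<open>(i, p, j)\<close>, so that distinct contacts give distinct parallel arcs.
\<close>

definition contact_graph ::
  "nat \<Rightarrow> (nat \<times> nat) set \<Rightarrow> (nat, nat \<times> (nat \<times> nat) \<times> nat) pre_digraph" where
  "contact_graph n P =
    \<lparr>verts = {1..n},
     arcs = {(i, p, j). i \<in> {1..n} \<and> j \<in> {1..n} \<and> p \<in> contacts n P \<and>
       enters P i p West \<and> enters P j p South},
     tail = (\<lambda>(i, p, j). i),
     head = (\<lambda>(i, p, j). j)\<rparr>"

definition APD :: "nat \<Rightarrow> (nat \<Rightarrow> nat) \<Rightarrow> (nat \<times> nat) set set" where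
  "APD n \<omega> = {P \<in> PD n \<omega>. \<nexists>w. pre_digraph.cycle (contact_graph n P) w}"

definition linear_extensions :: "nat \<Rightarrow> (nat \<times> nat) set \<Rightarrow> (nat \<Rightarrow> nat) set" where
  "linear_extensions n P =
    {\<pi>. \<pi> permutes {1..n} \<and>
      (\<forall>a \<in> arcs (contact_graph n P).
        inv \<pi> (tail (contact_graph n P) a) < inv \<pi> (head (contact_graph n P) a))}"

definition pipe_dream_congruence :: "nat \<Rightarrow> (nat \<Rightarrow> nat) \<Rightarrow> (nat \<Rightarrow> nat) rel" where
  "pipe_dream_congruence n \<omega> =
    {(x, y). \<exists>P \<in> APD n \<omega>. x \<in> linear_extensions n P \<and> y \<in> linear_extensions n P}"

end

theory Submission
  imports Defs
begin

text \<open>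
  Read the rows of a pipe dream from the top. If \<open>\<pi>\<close> is a linear extension, then the contacts of
  row \<open>r\<close> are exactly at the right-to-left minima, in the order of \<open>\<pi>\<close>, of the word of pipes leaving
  row \<open>r\<close>; so \<open>\<pi>\<close> determines its pipe dream, and for \<open>\<pi> \<le> \<omega>\<close> this rule constructs one. Counting
  the pipes to the right of \<open>j\<close> which precede \<open>j\<close> in \<open>\<pi>\<close> yields a closed formula for the rows in which
  pipe \<open>j\<close> turns. It follows that a cover \<open>U i j V < U j i V\<close> lies in one class (is contracted) iff
  the number of \<open>u\<close> in \<open>U\<close> between \<open>i\<close> and \<open>j\<close> lying to the right of \<open>j\<close> in \<open>\<omega>\<close> is at least the
  number of \<open>u < i\<close> lying to the left of \<open>j\<close> in \<open>\<omega>\<close>.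

  The covers that are not contracted are detected by a family of properties closed under going up
  and under meets, and by a dual family closed under going down and under joins. Two elements of a
  class are joined by adjacent transpositions inside the class, and two elements with the same
  properties are joined through their meet (or join); hence the equivalence is the kernel of either
  family, and it is compatible with meets by the first family and with joins by the second.

  Permutations \<open>\<pi>\<close> mostly occur through their position functions \<open>f = inv \<pi>\<close>.
\<close>

section \<open>Weak order through inversion sets; joins and meets as transitive closures\<close>

section \<open>Permutations as position functions\<close>

text \<open>Whether a cover \<open>U i j V < U j i V\<close> is contracted depends on
  \<open>U\<close> through a count, and such a count is not visibly respected by meets and joins,
  whose sets of non-inversions and of inversions are transitive closures. What does survive is
  membership in a principal filter or ideal. An up-test says that a permutation lies above the one
  whose only descent is \<open>j i\<close>, with the values of \<open>D\<close> placed before the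
  other values of the segment from \<open>i\<close> to \<open>j\<close>. A down-test says that it
  lies below the permutation whose only ascent is \<open>i j\<close>, again with \<open>D\<close> in
  front. The count moves into the choice of the admissible \<open>D\<close>: too few of its members
  may stand to the right of \<open>j\<close> in \<omega>. A cover that is not contracted supplies an
  admissible \<open>D\<close> separating its two ends, while no admissible \<open>D\<close>
  separates the ends of a contracted one. A filter gives no hold on joins, nor an ideal on meets;
  this is the reason for two families.\<close>

definition Inv :: "nat \<Rightarrow> (nat \<Rightarrow> nat) \<Rightarrow> (nat \<times> nat) set" where
  "Inv n f = {(i, j). i \<in> {1..n} \<and> j \<in> {1..n} \<and> i < j \<and> f j < f i}"

lemma inversions_eq_Inv: "inversions n \<pi> = Inv n (inv \<pi>)"
  by (simp add: inversions_def Inv_def)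

lemma permutes_ne: "f permutes S \<Longrightarrow> i \<noteq> j \<Longrightarrow> f i \<noteq> f j"
  by (meson injD permutes_inj)

lemma notin_Inv_iff:
  assumes "f permutes {1..n}" "i \<in> {1..n}" "j \<in> {1..n}" "i < j"
  shows "(i, j) \<notin> Inv n f \<longleftrightarrow> f i < f j"
  using assms permutes_ne[OF assms(1), of i j] by (auto simp: Inv_def)

lemma same_order_permutes_eq:
  fixes f g :: "nat \<Rightarrow> nat"
  assumes f: "f permutes {1..n}" and g: "g permutes {1..n}"
    and ord: "\<And>i j. i \<in> {1..n} \<Longrightarrow> j \<in> {1..n} \<Longrightarrow> f i < f j \<Longrightarrow> g i < g j"
  shows "f = g"
proof -
  have rank: "card {j \<in> {1..n}. h j < h i} = h i - 1"
    if h: "h permutes {1..n}" and i: "i \<in> {1..n}" for h :: "nat \<Rightarrow> nat" and i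
  proof -
    have im: "h x \<in> {1..n}" if "x \<in> {1..n}" for x
      using permutes_in_image[OF h] that by blast
    have "h ` {j \<in> {1..n}. h j < h i} = {1..<h i}"
    proof
      show "h ` {j \<in> {1..n}. h j < h i} \<subseteq> {1..<h i}"
        using im by fastforce
      show "{1..<h i} \<subseteq> h ` {j \<in> {1..n}. h j < h i}"
      proof
        fix y assume y: "y \<in> {1..<h i}"
        have "y \<in> {1..n}" using y im[OF i] by auto
        then obtain j where "j \<in> {1..n}" "h j = y"
          using permutes_image[OF h] by (metis imageE)
        then show "y \<in> h ` {j \<in> {1..n}. h j < h i}" using y by auto
      qed
    qed
    moreover have "inj_on h {j \<in> {1..n}. h j < h i}"
      using permutes_inj_on[OF h] .
    ultimately show ?thesis
      by (metis card_image card_atLeastLessThan)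
  qed
  show ?thesis
  proof
    fix i
    show "f i = g i"
    proof (cases "i \<in> {1..n}")
      case True
      have "{j \<in> {1..n}. f j < f i} = {j \<in> {1..n}. g j < g i}"
      proof -
        have "f j < f i" if "j \<in> {1..n}" "g j < g i" for j
          using ord[of i j] permutes_ne[OF f, of i j] that True
          by (metis less_asym linorder_neqE_nat nat_neq_iff)
        then show ?thesis using ord True by blast
      qed
      then have "f i - 1 = g i - 1" using rank f g True by metis
      moreover have "f i \<ge> 1" "g i \<ge> 1"
        using permutes_in_image[OF f, of i] permutes_in_image[OF g, of i] True
        by (metis atLeastAtMost_iff)+
      ultimately show ?thesis by linarith
    next
      case False
      then show ?thesis using f g by (simp add: permutes_not_in)
    qed
  qed
qed

lemma Inv_eq_imp_eq:
  assumes f: "f permutes {1..n}" and g: "g permutes {1..n}" and eq: "Inv n f = Inv n g"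
  shows "f = g"
proof (rule same_order_permutes_eq[OF f g])
  fix i j assume ij: "i \<in> {1..n}" "j \<in> {1..n}" "f i < f j"
  show "g i < g j"
  proof (cases "i < j")
    case True
    then show ?thesis using notin_Inv_iff[OF f] notin_Inv_iff[OF g] ij eq by blast
  next
    case False
    then have "(j, i) \<in> Inv n f" using ij by (auto simp: Inv_def) (metis less_irrefl nat_neq_iff)
    then show ?thesis using eq by (auto simp: Inv_def)
  qed
qed

lemma permutes_of_linear_order:
  fixes less :: "nat \<Rightarrow> nat \<Rightarrow> bool"
  assumes irr: "\<And>i. \<not> less i i"
    and trans: "\<And>i j k. i \<in> {1..n} \<Longrightarrow> j \<in> {1..n} \<Longrightarrow> k \<in> {1..n} \<Longrightarrow> less i j \<Longrightarrow> less j k \<Longrightarrow> less i k"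
    and total: "\<And>i j. i \<in> {1..n} \<Longrightarrow> j \<in> {1..n} \<Longrightarrow> i \<noteq> j \<Longrightarrow> less i j \<or> less j i"
  obtains f where "f permutes {1..n}"
    "\<And>i j. i \<in> {1..n} \<Longrightarrow> j \<in> {1..n} \<Longrightarrow> f i < f j \<longleftrightarrow> less i j"
proof -
  define f where "f i = (if i \<in> {1..n} then Suc (card {k \<in> {1..n}. less k i}) else i)" for i
  have mono: "f i < f j" if "i \<in> {1..n}" "j \<in> {1..n}" "less i j" for i j
  proof -
    have "{k \<in> {1..n}. less k i} \<subset> {k \<in> {1..n}. less k j}"
      using that trans irr by blast
    then show ?thesis using that by (simp add: f_def psubset_card_mono)
  qed
  have iff: "f i < f j \<longleftrightarrow> less i j" if "i \<in> {1..n}" "j \<in> {1..n}" for i j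
    using that mono total irr by (metis less_asym less_irrefl)
  have inj: "inj_on f {1..n}"
    by (rule inj_onI) (metis iff less_irrefl total)
  have "f i \<in> {1..n}" if "i \<in> {1..n}" for i
  proof -
    have "{k \<in> {1..n}. less k i} \<subset> {1..n}" using that irr by blast
    then have "card {k \<in> {1..n}. less k i} < n"
      using psubset_card_mono[of "{1..n}" "{k \<in> {1..n}. less k i}"] by simp
    then show ?thesis using that by (simp add: f_def)
  qed
  then have "f ` {1..n} \<subseteq> {1..n}" by blast
  then have "bij_betw f {1..n} {1..n}"
    using inj by (simp add: bij_betw_def endo_inj_surj)
  then have "f permutes {1..n}"
    by (rule bij_imp_permutes) (auto simp: f_def)
  then show ?thesis using iff that by blast
qed

text \<open>The classical description of inversion sets: \<open>T\<close> and its complement among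
  the pairs \<open>i < j\<close> are both transitive, \<open>cotrans\<close> being transitivity of
  the complement. Together they make the order obtained from the natural one by reversing exactly
  the pairs of \<open>T\<close> transitive.\<close>

lemma permutes_of_Inv:
  assumes T: "\<And>i j. (i, j) \<in> T \<Longrightarrow> i \<in> {1..n} \<and> j \<in> {1..n} \<and> i < j"
    and trans: "\<And>i j k. (i, j) \<in> T \<Longrightarrow> (j, k) \<in> T \<Longrightarrow> (i, k) \<in> T"
    and cotrans: "\<And>i j k. (i, k) \<in> T \<Longrightarrow> i < j \<Longrightarrow> j < k \<Longrightarrow> (i, j) \<in> T \<or> (j, k) \<in> T"
  obtains f where "f permutes {1..n}" "Inv n f = T"
proof -
  define less where "less i j \<longleftrightarrow> (i < j \<and> (i, j) \<notin> T) \<or> (j < i \<and> (j, i) \<in> T)" for i j :: nat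
  have irr: "\<not> less i i" for i by (simp add: less_def)
  have total: "less i j \<or> less j i" if "i \<noteq> j" for i j
    using that by (auto simp: less_def)
  have tr: "less i k" if "less i j" "less j k" for i j k
  proof -
    have ne: "i \<noteq> j" "j \<noteq> k" "i \<noteq> k" using that by (auto simp: less_def)
    show ?thesis
    proof (cases "i < k")
      case True
      then consider "i < j" "j < k" | "i < j" "k < j" | "j < i" "j < k" using ne by linarith
      then have "(i, k) \<notin> T"
      proof cases
        case 1
        then show ?thesis using that cotrans[of i k j] by (auto simp: less_def)
      next
        case 2
        then show ?thesis using that trans[of i k j] by (auto simp: less_def)
      next
        case 3
        then show ?thesis using that trans[of j i k] by (auto simp: less_def)
      qed
      then show ?thesis using True by (simp add: less_def)
    next
      case False
      then consider "i < j" "k < j" | "j < i" "j < k" | "j < i" "k < j" using ne by linarith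
      then have "(k, i) \<in> T"
      proof cases
        case 1
        then show ?thesis using that False ne cotrans[of k j i] by (auto simp: less_def)
      next
        case 2
        then show ?thesis using that False ne cotrans[of j i k] by (auto simp: less_def)
      next
        case 3
        then show ?thesis using that trans[of k j i] by (auto simp: less_def)
      qed
      then show ?thesis using False ne by (simp add: less_def)
    qed
  qed
  obtain f where f: "f permutes {1..n}"
    and iff: "\<And>i j. i \<in> {1..n} \<Longrightarrow> j \<in> {1..n} \<Longrightarrow> f i < f j \<longleftrightarrow> less i j"
    using permutes_of_linear_order[of less n] irr tr total by blast
  have "Inv n f = T"
  proof (intro equalityI subrelI)
    fix i j assume "(i, j) \<in> Inv n f"
    then show "(i, j) \<in> T"
      using iff[of j i] by (auto simp: Inv_def less_def)
  next
    fix i j assume "(i, j) \<in> T"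
    then show "(i, j) \<in> Inv n f"
      using iff[of j i] T by (auto simp: Inv_def less_def)
  qed
  then show ?thesis using f that by blast
qed

section \<open>Joins and meets in the weak order\<close>

definition NonInv :: "nat \<Rightarrow> (nat \<Rightarrow> nat) \<Rightarrow> (nat \<times> nat) set" where
  "NonInv n f = {(i, j). i \<in> {1..n} \<and> j \<in> {1..n} \<and> i < j \<and> f i < f j}"

lemma NonInv_iff:
  assumes "f permutes {1..n}" "i \<in> {1..n}" "j \<in> {1..n}" "i < j"
  shows "(i, j) \<in> NonInv n f \<longleftrightarrow> (i, j) \<notin> Inv n f"
  using notin_Inv_iff[OF assms] assms by (auto simp: NonInv_def)

text \<open>A chain from \<open>i\<close> to \<open>k\<close> either visits \<open>j\<close> or has
  a step jumping over \<open>j\<close>. In the latter case cotransitivity of the set containing this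
  step cuts it at \<open>j\<close>.\<close>

lemma trancl_union_cotrans:
  fixes A B :: "(nat \<times> nat) set"
  assumes A: "\<And>i j k. (i, k) \<in> A \<Longrightarrow> i < j \<Longrightarrow> j < k \<Longrightarrow> (i, j) \<in> A \<or> (j, k) \<in> A"
    and B: "\<And>i j k. (i, k) \<in> B \<Longrightarrow> i < j \<Longrightarrow> j < k \<Longrightarrow> (i, j) \<in> B \<or> (j, k) \<in> B"
    and ik: "(i, k) \<in> (A \<union> B)\<^sup>+" "i < j" "j < k"
  shows "(i, j) \<in> (A \<union> B)\<^sup>+ \<or> (j, k) \<in> (A \<union> B)\<^sup>+"
  using ik
proof (induction rule: trancl_induct)
  case (base k)
  then show ?case using A B by blast
next
  case (step l k)
  show ?case
  proof (cases "j < l")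
    case True
    then show ?thesis using step by (meson trancl.trancl_into_trancl)
  next
    case False
    show ?thesis
    proof (cases "j = l")
      case True
      then show ?thesis using step by blast
    next
      case False
      then have "(l, j) \<in> A \<union> B \<or> (j, k) \<in> A \<union> B"
        using step A B \<open>\<not> j < l\<close> by (metis UnCI UnE linorder_neqE_nat)
      then show ?thesis using step by (meson r_into_trancl trancl.trancl_into_trancl)
    qed
  qed
qed

lemma trancl_in_range:
  assumes "\<And>i j. (i, j) \<in> A \<Longrightarrow> i \<in> {1..n} \<and> j \<in> {1..n} \<and> i < (j::nat)"
    and "(i, j) \<in> A\<^sup>+"
  shows "i \<in> {1..n} \<and> j \<in> {1..n} \<and> i < j"
  using assms(2) by (induction rule: trancl_induct) (use assms(1) in \<open>fastforce+\<close>)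

lemma Inv_cotrans:
  "(i, k) \<in> Inv n f \<Longrightarrow> i < j \<Longrightarrow> j < k \<Longrightarrow> (i, j) \<in> Inv n f \<or> (j, k) \<in> Inv n f"
  by (auto simp: Inv_def)

lemma NonInv_cotrans:
  "(i, k) \<in> NonInv n f \<Longrightarrow> i < j \<Longrightarrow> j < k \<Longrightarrow> (i, j) \<in> NonInv n f \<or> (j, k) \<in> NonInv n f"
  by (auto simp: NonInv_def)

lemma weak_join_exists:
  obtains h where "h permutes {1..n}" "Inv n h = (Inv n f \<union> Inv n g)\<^sup>+"
proof (rule permutes_of_Inv[of "(Inv n f \<union> Inv n g)\<^sup>+" n])
  fix i j assume "(i, j) \<in> (Inv n f \<union> Inv n g)\<^sup>+"
  then show "i \<in> {1..n} \<and> j \<in> {1..n} \<and> i < j"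
    by (rule trancl_in_range[rotated]) (auto simp: Inv_def)
next
  fix i j k assume "(i, k) \<in> (Inv n f \<union> Inv n g)\<^sup>+" "i < j" "j < k"
  then show "(i, j) \<in> (Inv n f \<union> Inv n g)\<^sup>+ \<or> (j, k) \<in> (Inv n f \<union> Inv n g)\<^sup>+"
    by (rule trancl_union_cotrans[rotated 2]) (auto dest: Inv_cotrans)
qed (auto intro: that)

text \<open>The closure now describes the non-inversions, so the two conditions change roles: its
  cotransitivity makes the inversion set transitive, and its transitivity makes the inversion set
  cotransitive.\<close>

lemma weak_meet_exists:
  obtains h where "h permutes {1..n}" "NonInv n h = (NonInv n f \<union> NonInv n g)\<^sup>+"
proof -
  let ?N = "(NonInv n f \<union> NonInv n g)\<^sup>+"
  let ?T = "{(i, j). i \<in> {1..n} \<and> j \<in> {1..n} \<and> i < j \<and> (i, j) \<notin> ?N}"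
  have N: "i \<in> {1..n} \<and> j \<in> {1..n} \<and> i < j" if "(i, j) \<in> ?N" for i j
    using that by (rule trancl_in_range[rotated]) (auto simp: NonInv_def)
  have co: "(i, j) \<in> ?N \<or> (j, k) \<in> ?N" if "(i, k) \<in> ?N" "i < j" "j < k" for i j k
    using that by (rule trancl_union_cotrans[rotated 2]) (auto dest: NonInv_cotrans)
  obtain h where h: "h permutes {1..n}" "Inv n h = ?T"
  proof (rule permutes_of_Inv[of ?T n])
    fix i j k assume a: "(i, j) \<in> ?T" "(j, k) \<in> ?T"
    then have "(i, k) \<notin> ?N" using co[of i k j] by blast
    then show "(i, k) \<in> ?T" using a by auto
  next
    fix i j k assume a: "(i, k) \<in> ?T" "i < j" "j < k"
    then have "\<not> ((i, j) \<in> ?N \<and> (j, k) \<in> ?N)" by (blast intro: trancl_trans)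
    then show "(i, j) \<in> ?T \<or> (j, k) \<in> ?T" using a by auto
  qed (use that in auto)
  have "NonInv n h = ?N"
  proof (intro equalityI subrelI)
    fix i j assume a: "(i, j) \<in> NonInv n h"
    then have "(i, j) \<notin> Inv n h" by (auto simp: NonInv_def Inv_def)
    then show "(i, j) \<in> ?N" using a unfolding h(2) by (auto simp: NonInv_def)
  next
    fix i j assume a: "(i, j) \<in> ?N"
    then have "(i, j) \<notin> Inv n h" unfolding h(2) by blast
    then show "(i, j) \<in> NonInv n h" using NonInv_iff[OF h(1)] N[OF a] by blast
  qed
  then show ?thesis using h that by blast
qed

lemma Inv_trans: "(i, j) \<in> Inv n f \<Longrightarrow> (j, k) \<in> Inv n f \<Longrightarrow> (i, k) \<in> Inv n f"
  by (auto simp: Inv_def)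

lemma NonInv_trans: "(i, j) \<in> NonInv n f \<Longrightarrow> (j, k) \<in> NonInv n f \<Longrightarrow> (i, k) \<in> NonInv n f"
  by (auto simp: NonInv_def)

lemma Inv_subset_iff_NonInv:
  assumes "f permutes {1..n}" "g permutes {1..n}"
  shows "Inv n f \<subseteq> Inv n g \<longleftrightarrow> NonInv n g \<subseteq> NonInv n f"
proof -
  have "(i, j) \<in> NonInv n g \<longleftrightarrow> (i \<in> {1..n} \<and> j \<in> {1..n} \<and> i < j) \<and> (i, j) \<notin> Inv n g"
    "(i, j) \<in> NonInv n f \<longleftrightarrow> (i \<in> {1..n} \<and> j \<in> {1..n} \<and> i < j) \<and> (i, j) \<notin> Inv n f" for i j
    using NonInv_iff assms by (auto simp: NonInv_def)
  moreover have "(i, j) \<in> Inv n f \<Longrightarrow> i \<in> {1..n} \<and> j \<in> {1..n} \<and> i < j"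
    "(i, j) \<in> Inv n g \<Longrightarrow> i \<in> {1..n} \<and> j \<in> {1..n} \<and> i < j" for i j
    by (auto simp: Inv_def)
  ultimately show ?thesis by (meson subrelI subsetD)
qed

lemma trancl_subset_trans:
  assumes "A \<subseteq> B" "\<And>i j k. (i, j) \<in> B \<Longrightarrow> (j, k) \<in> B \<Longrightarrow> (i, k) \<in> B"
  shows "A\<^sup>+ \<subseteq> B"
  by (metis assms trancl_id trancl_mono_subset transI)

section \<open>Bubble sort between two permutations\<close>

section \<open>Adjacent transpositions\<close>

definition adj_swap :: "(nat \<Rightarrow> nat) \<Rightarrow> nat \<Rightarrow> nat \<Rightarrow> nat \<Rightarrow> nat" where
  "adj_swap f a b = f \<circ> Transposition.transpose a b"

lemma adj_swap_permutes:
  assumes "f permutes {1..n}" "a \<in> {1..n}" "b \<in> {1..n}"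
  shows "adj_swap f a b permutes {1..n}"
  unfolding adj_swap_def using assms by (intro permutes_compose permutes_swap_id)

lemma adj_swap_less_iff:
  assumes f: "f permutes {1..n}" and ab: "f b = Suc (f a)" 
  shows "adj_swap f a b x < adj_swap f a b y \<longleftrightarrow>
    (if x = a \<and> y = b then False else if x = b \<and> y = a then True else f x < f y)"
proof -
  have "a \<noteq> b" using ab by auto
  have "f x \<noteq> f a" if "x \<noteq> a" for x using permutes_ne[OF f] that by blast
  moreover have "f x \<noteq> f b" if "x \<noteq> b" for x using permutes_ne[OF f] that by blast
  ultimately show ?thesis
    using ab \<open>a \<noteq> b\<close> by (auto simp: adj_swap_def transpose_def) (metis Suc_lessI less_SucE less_Suc_eq not_less_eq)+
qed

text \<open>If \<open>g\<close> increased on all neighbours in the order of \<open>f\<close>, it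
  would increase along the whole of \<open>f\<close> and equal it.\<close>

lemma exists_adjacent_disagreement:
  fixes f g :: "nat \<Rightarrow> nat"
  assumes f: "f permutes {1..n}" and g: "g permutes {1..n}" and ne: "f \<noteq> g"
  obtains a b where "a \<in> {1..n}" "b \<in> {1..n}" "f b = Suc (f a)" "g b < g a"
proof (rule ccontr)
  assume "\<not> thesis"
  with that have no: "g a < g b" if "a \<in> {1..n}" "b \<in> {1..n}" "f b = Suc (f a)" for a b
    using that permutes_ne[OF g, of a b] by (metis linorder_neqE_nat n_not_Suc_n)
  have step: "g a < g b" if "a \<in> {1..n}" "b \<in> {1..n}" "f b = f a + Suc k" for a b k
    using that
  proof (induction k arbitrary: b)
    case 0
    then show ?case using no by simp
  next
    case (Suc k)
    have "f b \<in> {1..n}" using permutes_in_image[OF f] Suc by blast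
    then have "f a + Suc k \<in> {1..n}" using Suc by auto
    then obtain c where c: "c \<in> {1..n}" "f c = f a + Suc k"
      using permutes_image[OF f] by (metis imageE)
    then show ?case using Suc no[of c b] by (metis add_Suc_right less_trans)
  qed
  have "f = g"
  proof (rule same_order_permutes_eq[OF f g])
    fix i j assume "i \<in> {1..n}" "j \<in> {1..n}" "f i < f j"
    then show "g i < g j" using step[of i j "f j - f i - 1"] by simp
  qed
  with ne show False by blast
qed

text \<open>Each swap repairs a neighbouring pair of \<open>h\<close> that \<open>g\<close> orders
  the other way, so the number of disagreements with \<open>g\<close> drops, and pairs on which
  \<open>f\<close> and \<open>g\<close> agree are never touched. The two ends need not be
  comparable; when they are, the agreement condition handed to \<open>step\<close> keeps the path in
  their interval.\<close>

lemma adjacent_swap_path: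
  fixes f g :: "nat \<Rightarrow> nat"
  assumes f: "f permutes {1..n}" and g: "g permutes {1..n}"
    and start: "\<Phi> f"
    and step: "\<And>h a b. h permutes {1..n} \<Longrightarrow>
      (\<And>i j. i \<in> {1..n} \<Longrightarrow> j \<in> {1..n} \<Longrightarrow> f i < f j \<Longrightarrow> g i < g j \<Longrightarrow> h i < h j) \<Longrightarrow>
      a \<in> {1..n} \<Longrightarrow> b \<in> {1..n} \<Longrightarrow> h b = Suc (h a) \<Longrightarrow> g b < g a \<Longrightarrow> \<Phi> h \<Longrightarrow> \<Phi> (adj_swap h a b)"
  shows "\<Phi> g"
proof -
  define D where "D h = {(i, j). i \<in> {1..n} \<and> j \<in> {1..n} \<and> h i < h j \<and> g j < g i}" for h :: "nat \<Rightarrow> nat"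
  have fin: "finite (D h)" for h
    by (rule finite_subset[of _ "{1..n} \<times> {1..n}"]) (auto simp: D_def)
  have "\<Phi> h \<longrightarrow> \<Phi> g" if "h permutes {1..n}"
    "\<And>i j. i \<in> {1..n} \<Longrightarrow> j \<in> {1..n} \<Longrightarrow> f i < f j \<Longrightarrow> g i < g j \<Longrightarrow> h i < h j" for h
    using that
  proof (induction "card (D h)" arbitrary: h rule: less_induct)
    case less
    show ?case
    proof (cases "h = g")
      case False
      obtain a b where ab: "a \<in> {1..n}" "b \<in> {1..n}" "h b = Suc (h a)" "g b < g a"
        using exists_adjacent_disagreement[OF less.prems(1) g False] .
      let ?h = "adj_swap h a b"
      note iff = adj_swap_less_iff[OF less.prems(1) ab(3)]
      have "D ?h \<subset> D h"
      proof
        show "D ?h \<subseteq> D h" using ab unfolding D_def iff by (auto split: if_splits)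
        have "(a, b) \<in> D h" "(a, b) \<notin> D ?h" using ab unfolding D_def iff by auto
        then show "D ?h \<noteq> D h" by blast
      qed
      then have "card (D ?h) < card (D h)" using fin psubset_card_mono by blast
      moreover have "?h permutes {1..n}" using adj_swap_permutes less.prems(1) ab by blast
      moreover have "?h i < ?h j" if "i \<in> {1..n}" "j \<in> {1..n}" "f i < f j" "g i < g j" for i j
        unfolding iff using less.prems(2)[OF that] that ab by auto
      ultimately have "\<Phi> ?h \<longrightarrow> \<Phi> g" using less.hyps by blast
      then show ?thesis using step[OF less.prems ab] by blast
    qed simp
  qed
  then show ?thesis using f start by blast
qed

section \<open>Local structure of one row whose pipes are ordered by a permutation\<close>

section \<open>A single row of a pipe dream\<close>

text \<open>
  Row \<open>r\<close> has the cells \<open>1, \<dots>, m\<close>, of which those in \<open>K\<close> are crossings, and the elbow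
  \<open>m + 1\<close>. The pipe \<open>s c\<close> enters cell \<open>c\<close> from the south, \<open>w c\<close> enters it from the west, and
  \<open>t c\<close> leaves it to the north.
\<close>

locale pipe_cells =
  fixes m r :: nat and K :: "nat set" and s w t :: "nat \<Rightarrow> nat"
  assumes K_subset: "K \<subseteq> {1..m}"
    and w_first: "w (Suc 0) = r"
    and w_cross: "\<And>c. c \<in> {1..m} \<Longrightarrow> c \<in> K \<Longrightarrow> w (Suc c) = w c"
    and t_cross: "\<And>c. c \<in> {1..m} \<Longrightarrow> c \<in> K \<Longrightarrow> t c = s c"
    and w_turn: "\<And>c. c \<in> {1..m} \<Longrightarrow> c \<notin> K \<Longrightarrow> w (Suc c) = s c"
    and t_turn: "\<And>c. c \<in> {1..m} \<Longrightarrow> c \<notin> K \<Longrightarrow> t c = w c"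
    and t_last: "t (Suc m) = w (Suc m)"
begin

lemma t_turn': "c \<in> {1..Suc m} \<Longrightarrow> c \<notin> K \<Longrightarrow> t c = w c"
  using t_turn t_last by (cases "c = Suc m") auto

lemma t_image:
  assumes "1 \<le> c" "c \<le> Suc m"
  shows "t ` {c..Suc m} = insert (w c) (s ` {c..m})"
  using assms(2,1)
proof (induction rule: inc_induct)
  case base
  then show ?case using t_last by simp
next
  case (step c)
  then have c: "c \<in> {1..m}" by auto
  have 1: "{c..Suc m} = insert c {Suc c..Suc m}" "{c..m} = insert c {Suc c..m}"
    using c by auto
  show ?case
  proof (cases "c \<in> K")
    case True
    then show ?thesis using step w_cross[OF c] t_cross[OF c] unfolding 1 by auto
  next
    case False
    then show ?thesis using step w_turn[OF c] t_turn[OF c] unfolding 1 by auto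
  qed
qed

text \<open>Follow the pipe back westwards. It runs straight through crossings until the last
  contact before \<open>c\<close>, which it entered from the south, or, if there is no contact,
  until the left border.\<close>

lemma w_origin:
  assumes "1 \<le> c" "c \<le> Suc m"
  shows "w c = r \<and> {1..<c} \<subseteq> K \<or> (\<exists>e. 1 \<le> e \<and> e < c \<and> e \<notin> K \<and> {e<..<c} \<subseteq> K \<and> w c = s e)"
  using assms
proof (induction rule: dec_induct)
  case base
  then show ?case using w_first by simp
next
  case (step c)
  then have c: "c \<in> {1..m}" by auto
  show ?case
  proof (cases "c \<in> K")
    case True
    then have "w (Suc c) = w c" using w_cross c by blast
    moreover have "{1..<Suc c} = insert c {1..<c}" "e < c \<Longrightarrow> {e<..<Suc c} = insert c {e<..<c}" for e
      using c by auto
    ultimately show ?thesis using step True by (metis Suc_leD insert_subset less_SucI)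
  next
    case False
    then show ?thesis using w_turn[OF c] c by (intro disjI2 exI[of _ c]) auto
  qed
qed

lemma w_carried:
  assumes "1 \<le> c" "c \<le> d" "d \<le> Suc m" "{c..<d} \<subseteq> K"
  shows "w d = w c"
  using assms(2-4)
proof (induction rule: dec_induct)
  case (step d)
  have "d \<in> {c..<Suc d}" using step by simp
  then have "d \<in> K" using step by blast
  then have "d \<in> K" "d \<in> {1..m}" using K_subset by auto
  moreover have "{c..<d} \<subseteq> K" using step by auto
  ultimately show ?case using step w_cross[of d] by auto
qed simp

end

locale pipe_row = pipe_cells +
  assumes inj_s: "inj_on s {1..m}"
    and r_notin: "r \<notin> s ` {1..m}"
begin

lemma w_notin:
  assumes "1 \<le> c" "c \<le> Suc m"
  shows "w c \<notin> s ` {c..m}"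
proof
  assume "w c \<in> s ` {c..m}"
  then obtain d where d: "c \<le> d" "d \<le> m" "w c = s d" by auto
  then have "w c \<noteq> r" using r_notin assms by force
  then obtain e where "1 \<le> e" "e < c" "w c = s e" using w_origin[OF assms] by blast
  then show False using inj_onD[OF inj_s, of e d] d assms by auto
qed

lemma inj_t: "inj_on t {1..Suc m}"
proof (rule eq_card_imp_inj_on)
  have "t ` {1..Suc m} = insert r (s ` {1..m})" using t_image[of 1] w_first by simp
  then show "card (t ` {1..Suc m}) = card {1..Suc m}"
    using r_notin inj_s by (simp add: card_image)
qed simp

lemma w_stays:
  assumes "1 \<le> c" "c \<le> d" "d \<le> Suc m" "w c \<noteq> r"
  shows "w d \<noteq> r"
proof
  assume "w d = r"
  moreover have "s e \<noteq> r" if "1 \<le> e" "e < d" for e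
    using that r_notin assms by (metis atLeastAtMost_iff image_eqI less_Suc_eq_le order_less_le_trans)
  ultimately have "{1..<d} \<subseteq> K" using w_origin[of d] assms by fastforce
  moreover obtain e where "1 \<le> e" "e < c" "e \<notin> K" using w_origin[of c] assms by auto
  moreover from this have "e \<in> {1..<d}" using assms by simp
  ultimately show False by blast
qed

lemma s_ne_r: "c \<in> {1..m} \<Longrightarrow> s c \<noteq> r"
  using r_notin by blast

end

text \<open>At a contact, \<open>prec\<close> is an arc of the contact graph. At a crossing it only
  concerns two pipes that both come from below: they have not crossed yet, so their order is forced.
  Pipe \<open>r\<close>, which is new in this row, may cross earlier and later pipes; hence the
  exception.\<close>

locale ordered_pipe_row = pipe_row +
  fixes f :: "nat \<Rightarrow> nat"
  assumes inj_f: "inj f"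
    and prec: "\<And>c. c \<in> {1..m} \<Longrightarrow> c \<notin> K \<or> w c \<noteq> r \<Longrightarrow> f (w c) < f (s c)"
begin

lemma w_mono:
  assumes "1 \<le> c" "c \<le> d" "d \<le> Suc m"
  shows "f (w c) \<le> f (w d)"
  using assms(2,3)
proof (induction rule: dec_induct)
  case base
  then show ?case by simp
next
  case (step d)
  then have d: "d \<in> {1..m}" using assms by auto
  have "f (w d) \<le> f (w (Suc d))"
    using w_cross[OF d] w_turn[OF d] prec[OF d] by (cases "d \<in> K") auto
  then show ?case using step by auto
qed

lemma w_le_t:
  assumes "1 \<le> c" "c \<le> d" "d \<le> Suc m" "w c \<noteq> r"
  shows "f (w c) \<le> f (t d)"
proof (cases "d \<in> K")
  case True
  then have "d \<in> {1..m}" using K_subset by blast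
  then show ?thesis using w_stays[OF assms] w_mono[OF assms(1-3)] prec t_cross True
    by (metis less_imp_le le_trans)
next
  case False
  then show ?thesis using t_turn' w_mono assms by simp
qed

text \<open>After the contact the eastbound pipe is \<open>s c\<close>, which is later than
  \<open>t c\<close>, and nothing leaving the row further east is earlier than \<open>s c\<close>.
  Since pipe \<open>r\<close> is no longer the eastbound one, \<open>prec\<close> is available at
  the crossings too.\<close>

lemma turn_less:
  assumes "c \<in> {1..m}" "c \<notin> K" "c < d" "d \<le> Suc m"
  shows "f (t c) < f (t d)"
proof -
  have "f (t c) < f (w (Suc c))" using prec w_turn t_turn assms by auto
  also have "\<dots> \<le> f (t d)"
    using w_le_t[of "Suc c" d] w_turn[of c] s_ne_r[of c] assms by simp
  finally show ?thesis .
qed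

lemma cross_w_less:
  assumes "c \<in> K" "f r \<le> f (t c)"
  shows "f (w c) < f (t c)"
proof -
  have c: "c \<in> {1..m}" using assms K_subset by blast
  then have t: "t c = s c" using t_cross assms by blast
  show ?thesis
  proof (cases "w c = r")
    case True
    then show ?thesis using assms s_ne_r[OF c] inj_f t by (metis injD order_le_less)
  qed (use prec c t in auto)
qed

text \<open>The eastbound pipe starts as \<open>r\<close> and only gets later, so comparing
  \<open>t c\<close> with the pipe it crosses amounts to comparing it with \<open>r\<close>. This
  lets the count below depend on the row number alone.\<close>

lemma cross_r_less:
  assumes "c \<in> K"
  shows "f (w c) < f (t c) \<longleftrightarrow> f r < f (t c)"
proof
  assume "f (w c) < f (t c)"
  moreover have "f r \<le> f (w c)"
    using w_mono[of 1 c] w_first K_subset assms by auto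
  ultimately show "f r < f (t c)" by simp
qed (use cross_w_less assms in auto)

lemma w_in_right:
  assumes "c \<in> K"
  shows "t ` {c<..Suc m} = insert (w c) (s ` {c<..m})" "w c \<notin> s ` {c<..m}"
proof -
  have c: "c \<in> {1..m}" using assms K_subset by blast
  have "{c<..Suc m} = {Suc c..Suc m}" "{c<..m} = {Suc c..m}" by auto
  then show "t ` {c<..Suc m} = insert (w c) (s ` {c<..m})" "w c \<notin> s ` {c<..m}"
    using t_image[of "Suc c"] w_notin[of "Suc c"] w_cross[OF c assms] c by auto
qed

lemma turn_iff:
  assumes "c \<in> {1..Suc m}"
  shows "c \<notin> K \<longleftrightarrow> f r \<le> f (t c) \<and> {u \<in> t ` {c<..Suc m}. f u < f (t c)} = {}"
proof (cases "c \<in> K")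
  case True
  have "w c \<in> {u \<in> t ` {c<..Suc m}. f u < f (t c)}" if "f r \<le> f (t c)"
    using w_in_right(1)[OF True] cross_w_less[OF True that] by simp
  then show ?thesis using True by blast
next
  case False
  have "f r \<le> f (t c)" using w_mono[of 1 c] w_first assms t_turn'[OF assms False] by auto
  moreover have "\<not> f u < f (t c)" if "u \<in> t ` {c<..Suc m}" for u
    using turn_less[of c] that False assms by fastforce
  ultimately show ?thesis using False by blast
qed

text \<open>
  The truncation of the subtraction matters: if pipe \<open>t c\<close> turns in row \<open>r\<close>, then no earlier pipe
  is to its right, above as well as below this row.
\<close>

lemma card_right_step:
  assumes c: "c \<in> {1..Suc m}" and ne: "t c \<noteq> r"
  obtains e where "e \<in> {1..m}" "s e = t c"
    "card {u \<in> s ` {e<..m}. f u < f (t c)} =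
      card {u \<in> t ` {c<..Suc m}. f u < f (t c)} - (if f r < f (t c) then 1 else 0)"
proof (cases "c \<in> K")
  case True
  then have c: "c \<in> {1..m}" using K_subset by blast
  \<comment> \<open>The crossing moves \<open>w c\<close> from the left of \<open>t c\<close> below
    the row to its right above the row; all other pipes keep their side.\<close>
  have "{u \<in> t ` {c<..Suc m}. f u < f (t c)} =
      (if f r < f (t c) then insert (w c) {u \<in> s ` {c<..m}. f u < f (t c)}
       else {u \<in> s ` {c<..m}. f u < f (t c)})"
    using w_in_right(1)[OF True] cross_r_less[OF True] by auto
  then have "card {u \<in> s ` {c<..m}. f u < f (t c)} =
      card {u \<in> t ` {c<..Suc m}. f u < f (t c)} - (if f r < f (t c) then 1 else 0)"
    using w_in_right(2)[OF True] by simp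
  then show ?thesis using that[of c] c t_cross True by auto
next
  case False
  then have tw: "t c = w c" using t_turn' c by blast
  then obtain e where e: "1 \<le> e" "e < c" "e \<notin> K" "{e<..<c} \<subseteq> K" "w c = s e"
    using w_origin[of c] c ne by auto
  have em: "e \<in> {1..m}" using e c by auto
  have ws: "w (Suc e) = s e" using w_turn em e by blast
  \<comment> \<open>Pipe \<open>t c\<close> arrived through the contact \<open>e\<close>. What lies
    to its right below the row also leaves the row to the right of \<open>e\<close>, where no pipe
    is earlier than the eastbound pipe \<open>s e = t c\<close>.\<close>
  have "\<not> f u < f (t c)" if "u \<in> s ` {e<..m}" for u
  proof -
    have "{e<..m} = {Suc e..m}" by auto
    then have "u \<in> t ` {Suc e..Suc m}" using t_image[of "Suc e"] that em by auto
    then obtain d where d: "Suc e \<le> d" "d \<le> Suc m" "u = t d" by auto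
    then show ?thesis
      using w_le_t[of "Suc e" d] ws s_ne_r[OF em] e tw by simp
  qed
  then have "{u \<in> s ` {e<..m}. f u < f (t c)} = {}" by blast
  moreover have "{u \<in> t ` {c<..Suc m}. f u < f (t c)} = {}" using turn_iff[OF c] False by blast
  ultimately show ?thesis using that[of e] em e tw by (metis card.empty diff_0_eq_0)
qed

end

section \<open>Inversions along a row\<close>

text \<open>\<open>C i j\<close> stands for: \<open>i\<close> and \<open>j\<close> have crossed in a
  lower row. The assumptions \<open>resp_s\<close> and \<open>crossed\<close> form the invariant
  that is carried upwards through the rows; \<open>once\<close> is where the rule enters that two
  pipes cross at most once.\<close>

locale reduced_pipe_row = pipe_row +
  fixes f :: "nat \<Rightarrow> nat" and C :: "nat \<Rightarrow> nat \<Rightarrow> bool"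
  assumes inj_f': "inj f"
    and r_less: "\<And>c. c \<in> {1..m} \<Longrightarrow> r < s c"
    and resp_s: "\<And>c d. 1 \<le> c \<Longrightarrow> c < d \<Longrightarrow> d \<le> m \<Longrightarrow> s c < s d \<Longrightarrow> f (s c) < f (s d)"
    and chain: "\<And>c. c \<in> {1..m} \<Longrightarrow> c \<notin> K \<Longrightarrow> f (w c) < f (s c)"
    and crossed: "\<And>c d. 1 \<le> c \<Longrightarrow> c < d \<Longrightarrow> d \<le> m \<Longrightarrow> s d < s c \<Longrightarrow> C (s c) (s d)"
    and once: "\<And>c. c \<in> K \<Longrightarrow> \<not> C (w c) (s c)"
begin

text \<open>A west pipe other than \<open>r\<close> came from below at some \<open>e\<close> left of
  \<open>c\<close>; if it were the larger one, the two pipes would have crossed already.\<close>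

lemma cross_less:
  assumes "c \<in> K"
  shows "w c < s c"
proof -
  have c: "c \<in> {1..m}" using assms K_subset by blast
  show ?thesis
  proof (cases "w c = r")
    case True
    then show ?thesis using r_less c by auto
  next
    case False
    then obtain e where e: "1 \<le> e" "e < c" "w c = s e" using w_origin[of c] c by auto
    then have "\<not> s c < s e" using crossed[of e c] once[OF assms] c by auto
    moreover have "s c \<noteq> s e" using inj_onD[OF inj_s, of c e] c e by auto
    ultimately show ?thesis using e by simp
  qed
qed

lemma is_ordered: "ordered_pipe_row m r K s w t f"
proof unfold_locales
  fix c assume c: "c \<in> {1..m}" and "c \<notin> K \<or> w c \<noteq> r"
  show "f (w c) < f (s c)"
  proof (cases "c \<in> K")
    case True
    then have "w c \<noteq> r" using \<open>c \<notin> K \<or> w c \<noteq> r\<close> by blast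
    then obtain e where e: "1 \<le> e" "e < c" "w c = s e" using w_origin[of c] c by auto
    then show ?thesis using resp_s[of e c] cross_less[OF True] c by auto
  qed (use chain c in blast)
qed (use inj_f' in auto)

interpretation ordered_pipe_row m r K s w t f by (rule is_ordered)

text \<open>If the left pipe turns, \<open>turn_less\<close> decides. If it goes straight and the
  right one turns, the latter came from the south at a contact \<open>e\<close>. With
  \<open>e < c\<close> it would cross the left pipe at \<open>c\<close>, and
  \<open>cross_less\<close> would make it the smaller one; so \<open>c < e\<close>, and the order is
  inherited from below.\<close>

lemma resp_t:
  assumes "1 \<le> c" "c < d" "d \<le> Suc m" "t c < t d"
  shows "f (t c) < f (t d)"
proof (cases "c \<in> K")
  case False
  then show ?thesis using turn_less[of c d] assms by auto
next
  case cK: True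
  then have c: "c \<in> {1..m}" "t c = s c" using K_subset t_cross by auto
  show ?thesis
  proof (cases "d \<in> K")
    case True
    then show ?thesis using resp_s[of c d] t_cross K_subset c assms by auto
  next
    case dK: False
    then have td: "t d = w d" using t_turn' assms by auto
    show ?thesis
    proof (cases "w d = r")
      case True
      then show ?thesis using r_less[OF c(1)] c assms td by simp
    next
      case False
      then obtain e where e: "1 \<le> e" "e < d" "{e<..<d} \<subseteq> K" "w d = s e" "e \<notin> K"
        using w_origin[of d] assms by auto
      have "c \<noteq> e" using cK e by auto
      moreover have "\<not> e < c"
      proof
        assume "e < c"
        then have "{c..<d} \<subseteq> K" using e cK by auto
        then have "w c = s e" using w_carried[of c d] assms e by simp
        then show False using cross_less[OF cK] assms c e td by simp
      qed
      ultimately have "c < e" by simp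
      then show ?thesis using resp_s[of c e] e c td assms by simp
    qed
  qed
qed

text \<open>If the left pipe turns at \<open>c\<close>, it came from below at a column before
  \<open>c\<close> and the other one from a column at or after \<open>c\<close>, so they were out of
  order below. If it goes straight, either the right pipe crosses it at \<open>c\<close> or the pair
  is again inherited.\<close>

lemma crossed_t:
  assumes "1 \<le> c" "c < d" "d \<le> Suc m" "t d < t c"
  shows "C (t c) (t d) \<or> (\<exists>e \<in> K. (t d = w e \<and> t c = s e))"
proof (cases "c \<in> K")
  case cK: True
  then have c: "c \<in> {1..m}" "t c = s c" using K_subset t_cross by auto
  show ?thesis
  proof (cases "d \<in> K")
    case True
    then show ?thesis using crossed[of c d] t_cross K_subset c assms by auto
  next
    case dK: False
    then have td: "t d = w d" using t_turn' assms by auto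
    show ?thesis
    proof (cases "w c = w d")
      case True
      then show ?thesis using cK c td by metis
    next
      case False
      then obtain e where e: "1 \<le> e" "e < d" "{e<..<d} \<subseteq> K" "w d = s e" "e \<notin> K"
      proof -
        have "\<not> {1..<d} \<subseteq> K"
        proof
          assume "{1..<d} \<subseteq> K"
          then have "{c..<d} \<subseteq> K" using assms by auto
          then show False using w_carried[of c d] assms False by simp
        qed
        then show ?thesis using w_origin[of d] assms that by auto
      qed
      have "c \<noteq> e" using cK e by auto
      moreover have "\<not> e < c"
      proof
        assume "e < c"
        then have "{c..<d} \<subseteq> K" using e cK by auto
        then have "w c = w d" using w_carried[of c d] assms by simp
        then show False using False by simp
      qed
      ultimately have "c < e" by simp
      then show ?thesis using crossed[of c e] e c td assms by simp
    qed
  qed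
next
  case False
  then have tc: "t c = w c" using t_turn' assms by auto
  have "t c \<noteq> r"
  proof
    assume "t c = r"
    then have "t d < r" using assms by simp
    moreover have "t d \<in> insert r (s ` {1..m})"
      using t_image[of 1] w_first assms by auto
    ultimately show False using r_less by fastforce
  qed
  then obtain e where e: "1 \<le> e" "e < c" "t c = s e" using w_origin[of c] assms tc by auto
  obtain d' where d': "d' \<in> {c..m}" "t d = s d'"
  proof -
    have "t d \<in> insert (w c) (s ` {c..m})" using t_image[of c] assms by auto
    moreover have "t d \<noteq> w c" using tc assms by auto
    ultimately show ?thesis using that by auto
  qed
  then show ?thesis using crossed[of e d'] e assms by auto
qed

end

section \<open>From the set of crossings to the words of pipes between the rows\<close>

section \<open>The rows of a pipe dream\<close>

text \<open>
  \<open>W r c\<close> is the pipe entering the cell \<open>(r, c)\<close> from the west, and \<open>T r c\<close> the pipe leaving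
  it to the north.
\<close>

locale pipe_rows =
  fixes n :: nat and P :: "(nat \<times> nat) set" and T W :: "nat \<Rightarrow> nat \<Rightarrow> nat"
  assumes P_subset: "P \<subseteq> inner_cells n"
    and W_first: "\<And>r. r \<in> {1..n} \<Longrightarrow> W r (Suc 0) = r"
    and W_cross: "\<And>r c. r \<in> {1..n} \<Longrightarrow> c \<in> {1..n - r} \<Longrightarrow> (r, c) \<in> P \<Longrightarrow> W r (Suc c) = W r c"
    and T_cross: "\<And>r c. r \<in> {1..n} \<Longrightarrow> c \<in> {1..n - r} \<Longrightarrow> (r, c) \<in> P \<Longrightarrow> T r c = T (Suc r) c"
    and W_turn: "\<And>r c. r \<in> {1..n} \<Longrightarrow> c \<in> {1..n - r} \<Longrightarrow> (r, c) \<notin> P \<Longrightarrow> W r (Suc c) = T (Suc r) c"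
    and T_turn: "\<And>r c. r \<in> {1..n} \<Longrightarrow> c \<in> {1..n - r} \<Longrightarrow> (r, c) \<notin> P \<Longrightarrow> T r c = W r c"
    and T_last: "\<And>r. r \<in> {1..n} \<Longrightarrow> T r (Suc (n - r)) = W r (Suc (n - r))"
begin

lemma P_cell: "(r, c) \<in> P \<Longrightarrow> r \<in> {1..n} \<and> c \<in> {1..n - r}"
  using P_subset by (auto simp: inner_cells_def)

lemma T_turn': "r \<in> {1..n} \<Longrightarrow> 1 \<le> c \<Longrightarrow> r + c \<le> Suc n \<Longrightarrow> (r, c) \<notin> P \<Longrightarrow> T r c = W r c"
  using T_turn[of r c] T_last[of r] by (cases "c = Suc (n - r)") auto

lemma entersD:
  assumes "enters P j p sd" "j \<in> {1..n}"
  shows "(case sd of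
      West \<Rightarrow> 1 \<le> fst p \<and> 1 \<le> snd p \<and> fst p + snd p \<le> Suc n \<and> W (fst p) (snd p) = j
    | South \<Rightarrow> 1 \<le> snd p \<and> fst p + snd p \<le> n \<and> T (Suc (fst p)) (snd p) = j)"
  using assms(1)
proof (induction rule: enters.induct)
  case start
  then show ?case using W_first assms(2) by auto
next
  case (cross_east r c)
  then show ?case using P_cell[of "Suc r" c] W_cross[of "Suc r" c] by auto
next
  case (cross_north r c)
  then show ?case using P_cell[of "Suc r" c] T_cross[of "Suc r" c] by auto
next
  case (turn_north r c)
  then show ?case using T_turn'[of "Suc r" c] by auto
next
  case (turn_east r c)
  then show ?case using W_turn[of "Suc r" c] by auto
qed

text \<open>Pipes are followed from the bottom row upwards and, within a row, from left to right,
  because the pipes entering a cell come from below and from the west.\<close>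

lemma entersI:
  assumes "1 \<le> r" "r \<le> Suc n"
  shows "(\<forall>c. 1 \<le> c \<longrightarrow> r + c \<le> Suc n \<longrightarrow> enters P (T r c) (r - 1, c) South) \<and>
    (r \<le> n \<longrightarrow> (\<forall>c. 1 \<le> c \<longrightarrow> r + c \<le> Suc n \<longrightarrow> enters P (W r c) (r, c) West))"
  using assms(2,1)
proof (induction rule: inc_induct)
  case base
  then show ?case by simp
next
  case (step r)
  then obtain r' where r': "r = Suc r'" by (cases r) auto
  have r: "r \<in> {1..n}" using step by auto
  have S: "enters P (T (Suc r) c) (r, c) South" if "1 \<le> c" "r + c \<le> n" for c
    using step that by auto
  have Wc: "enters P (W r c) (r, c) West" if "1 \<le> c" "r + c \<le> Suc n" for c
    using that
  proof (induction rule: dec_induct)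
    case base
    then show ?case using W_first[OF r] enters.start by simp
  next
    case (step c)
    then have c: "c \<in> {1..n - r}" by auto
    have 1: "enters P (W r c) (r, c) West" using step by auto
    have 2: "enters P (T (Suc r) c) (r, c) South" using S step by auto
    show ?case
    proof (cases "(r, c) \<in> P")
      case True
      then show ?thesis using W_cross[OF r c] 1 enters.cross_east unfolding r' by metis
    next
      case False
      then show ?thesis using W_turn[OF r c] 2 enters.turn_east unfolding r' by metis
    qed
  qed
  have "enters P (T r c) (r - 1, c) South" if "1 \<le> c" "r + c \<le> Suc n" for c
  proof (cases "(r, c) \<in> P")
    case True
    then have c: "c \<in> {1..n - r}" using P_cell by blast
    then have "enters P (T (Suc r) c) (r, c) South" using S by auto
    then show ?thesis using T_cross[OF r c True] True enters.cross_north unfolding r' by force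
  next
    case False
    then show ?thesis
      using T_turn'[OF r that False] Wc[OF that] enters.turn_north unfolding r' by force
  qed
  then show ?case using Wc by blast
qed

lemma enters_West_iff:
  assumes "j \<in> {1..n}"
  shows "enters P j (r, c) West \<longleftrightarrow> 1 \<le> r \<and> 1 \<le> c \<and> r + c \<le> Suc n \<and> W r c = j"
proof
  assume "enters P j (r, c) West"
  then show "1 \<le> r \<and> 1 \<le> c \<and> r + c \<le> Suc n \<and> W r c = j" using entersD assms by fastforce
next
  assume "1 \<le> r \<and> 1 \<le> c \<and> r + c \<le> Suc n \<and> W r c = j"
  then show "enters P j (r, c) West" using entersI[of r] by auto
qed

lemma enters_South_iff:
  assumes "j \<in> {1..n}"
  shows "enters P j (r, c) South \<longleftrightarrow> 1 \<le> c \<and> r + c \<le> n \<and> T (Suc r) c = j"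
proof
  assume "enters P j (r, c) South"
  then show "1 \<le> c \<and> r + c \<le> n \<and> T (Suc r) c = j" using entersD assms by fastforce
next
  assume "1 \<le> c \<and> r + c \<le> n \<and> T (Suc r) c = j"
  then show "enters P j (r, c) South" using entersI[of "Suc r"] by auto
qed

abbreviation crossing_columns :: "nat \<Rightarrow> nat set" where
  "crossing_columns r \<equiv> {c. (r, c) \<in> P}"

lemma pipe_rowI:
  assumes "r \<in> {1..n}" "inj_on (T (Suc r)) {1..n - r}" "T (Suc r) ` {1..n - r} = {Suc r..n}"
  shows "pipe_row (n - r) r (crossing_columns r) (T (Suc r)) (W r) (T r)"
  using assms P_cell by unfold_locales (auto simp: W_first W_cross T_cross W_turn T_turn T_last)

lemma T_bij:
  assumes "1 \<le> r" "r \<le> Suc n"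
  shows "inj_on (T r) {1..Suc n - r} \<and> T r ` {1..Suc n - r} = {r..n}"
  using assms(2,1)
proof (induction rule: inc_induct)
  case base
  then show ?case by simp
next
  case (step r)
  then have r: "r \<in> {1..n}" by auto
  interpret row: pipe_row "n - r" r "crossing_columns r" "T (Suc r)" "W r" "T r"
    by (rule pipe_rowI) (use r step in auto)
  have "T r ` {1..Suc (n - r)} = insert r {Suc r..n}"
    using row.t_image[of 1] row.w_first step by simp
  also have "\<dots> = {r..n}" using r by auto
  finally show ?case using row.inj_t r by (simp add: Suc_diff_le)
qed

lemma row: "r \<in> {1..n} \<Longrightarrow> pipe_row (n - r) r (crossing_columns r) (T (Suc r)) (W r) (T r)"
  using pipe_rowI[of r] T_bij[of "Suc r"] by auto

lemma T_range: "r \<in> {1..n} \<Longrightarrow> c \<in> {1..Suc n - r} \<Longrightarrow> T r c \<in> {r..n}"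
  using T_bij[of r] by auto

lemma W_range:
  assumes "r \<in> {1..n}" "c \<in> {1..Suc n - r}"
  shows "W r c \<in> {r..n}"
proof -
  interpret row: pipe_row "n - r" r "crossing_columns r" "T (Suc r)" "W r" "T r"
    by (rule row) (use assms in auto)
  have "W r c \<in> T r ` {c..Suc (n - r)}" using row.t_image[of c] assms by auto
  then show ?thesis using T_range assms by auto
qed

lemma T_surj:
  assumes "r \<in> {1..n}" "j \<in> {r..n}"
  obtains c where "c \<in> {1..Suc n - r}" "T r c = j"
  using T_bij[of r] assms by (metis atLeastAtMost_iff imageE le_SucI)

text \<open>Pipe \<open>r\<close> only arrives in row \<open>r\<close>, where it enters from the west, so it leaves this row by a turn.\<close>

lemma own_row_turn:
  assumes "r \<in> {1..n}" "T r c = r"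
  shows "(r, c) \<notin> P"
proof
  assume "(r, c) \<in> P"
  interpret row: pipe_row "n - r" r "crossing_columns r" "T (Suc r)" "W r" "T r"
    by (rule row) (use assms in auto)
  show False using row.t_cross row.s_ne_r P_cell \<open>(r, c) \<in> P\<close> assms by (metis mem_Collect_eq)
qed

end

text \<open>Column \<open>c\<close> of \<open>carried\<close> is the pipe entering cell
  \<open>c\<close> from the west. Columns start at 1, so the value at 0 is a filler.\<close>

fun carried :: "nat set \<Rightarrow> (nat \<Rightarrow> nat) \<Rightarrow> nat \<Rightarrow> nat \<Rightarrow> nat" where
  "carried K s r 0 = r"
| "carried K s r (Suc c) = (if c = 0 then r else if c \<in> K then carried K s r c else s c)"

text \<open>In \<open>north P n k\<close> the rows are counted from the bottom.\<close>

primrec north :: "(nat \<times> nat) set \<Rightarrow> nat \<Rightarrow> nat \<Rightarrow> nat \<Rightarrow> nat" where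
  "north P n 0 = (\<lambda>c. 0)"
| "north P n (Suc k) = (\<lambda>c. if (n - k, c) \<in> P then north P n k c
    else carried {c. (n - k, c) \<in> P} (north P n k) (n - k) c)"

lemma pipe_rows_exist:
  assumes "P \<subseteq> inner_cells n"
  obtains T W where "pipe_rows n P T W"
proof -
  define T where "T r = north P n (Suc n - r)" for r
  define W where "W r = carried {c. (r, c) \<in> P} (T (Suc r)) r" for r
  have T: "T r c = (if (r, c) \<in> P then T (Suc r) c else W r c)" if "r \<in> {1..n}" for r c
    using that by (simp add: T_def W_def Suc_diff_le)
  have W: "W r (Suc c) = (if c = 0 then r else if (r, c) \<in> P then W r c else T (Suc r) c)" for r c
    by (simp add: W_def)
  have "pipe_rows n P T W"
  proof
    fix r assume r: "r \<in> {1..n}"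
    have "(r, Suc (n - r)) \<notin> P" using assms r by (auto simp: inner_cells_def)
    then show "T r (Suc (n - r)) = W r (Suc (n - r))" using T[OF r] by simp
  next
    fix r c assume "r \<in> {1..n}" "c \<in> {1..n - r}"
    note T' = T[OF this(1), of c] and W' = W[of r c]
    { assume "(r, c) \<in> P"
      then show "T r c = T (Suc r) c" "W r (Suc c) = W r c"
        using T' W' \<open>c \<in> _\<close> by simp_all }
    { assume "(r, c) \<notin> P"
      then show "T r c = W r c" "W r (Suc c) = T (Suc r) c"
        using T' W' \<open>c \<in> _\<close> by simp_all }
  qed (use assms W in auto)
  then show ?thesis using that by blast
qed

text \<open>Read downwards. Given the word above row \<open>r\<close>, the predicate
  \<open>Z\<close> decides every cell not left by pipe \<open>r\<close>, and pipe \<open>r\<close>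
  turns. The west pipes then follow from right to left: a contact shows its west pipe as the
  outgoing one, a crossing has the same west pipe as the cell east of it. Both together give the
  word below the row.\<close>

lemma pipe_rows_unique:
  assumes "pipe_rows n P T W" "pipe_rows n P' T' W'"
    and top: "\<And>c. c \<in> {1..n} \<Longrightarrow> T 1 c = T' 1 c"
    and Z: "\<And>r c. r \<in> {1..n} \<Longrightarrow> c \<in> {1..n - r} \<Longrightarrow> T r c \<noteq> r \<Longrightarrow> (r, c) \<in> P \<longleftrightarrow> Z r (T r c)"
    and Z': "\<And>r c. r \<in> {1..n} \<Longrightarrow> c \<in> {1..n - r} \<Longrightarrow> T' r c \<noteq> r \<Longrightarrow> (r, c) \<in> P' \<longleftrightarrow> Z r (T' r c)"
  shows "P = P'"
proof -
  interpret A: pipe_rows n P T W by fact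
  interpret B: pipe_rows n P' T' W' by fact
  have P: "(r, c) \<in> P \<longleftrightarrow> (r, c) \<in> P'"
    if "r \<in> {1..n}" "c \<in> {1..n - r}" "T r c = T' r c" for r c
    using Z[OF that(1,2)] Z'[OF that(1,2)] A.own_row_turn[OF that(1)] B.own_row_turn[OF that(1)]
      that(3) by metis
  have T: "\<forall>c \<in> {1..Suc n - r}. T r c = T' r c" if "1 \<le> r" "r \<le> n" for r
    using that
  proof (induction rule: dec_induct)
    case base
    then show ?case using top by simp
  next
    case (step r)
    then have r: "r \<in> {1..n}" by auto
    have Tr: "T r c = T' r c" if "c \<in> {1..Suc n - r}" for c
      using step.IH step.prems that by simp
    have W: "W r c = W' r c" if "1 \<le> c" "c \<le> Suc (n - r)" for c
      using that(2,1)
    proof (induction rule: inc_induct)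
      case base
      then show ?case using A.T_last[OF r] B.T_last[OF r] Tr r by (simp add: Suc_diff_le)
    next
      case (step c)
      then have c: "c \<in> {1..n - r}" by auto
      then have eq: "T r c = T' r c" using Tr by auto
      show ?case
        using P[OF r c eq] A.W_cross[OF r c] B.W_cross[OF r c] A.T_turn[OF r c] B.T_turn[OF r c] step eq c
        by (metis Suc_le_mono atLeastAtMost_iff le_SucI)
    qed
    show ?case
    proof
      fix c assume "c \<in> {1..Suc n - Suc r}"
      then have c: "c \<in> {1..n - r}" by auto
      then have eq: "T r c = T' r c" using Tr by auto
      show "T (Suc r) c = T' (Suc r) c"
        using P[OF r c eq] A.T_cross[OF r c] B.T_cross[OF r c] A.W_turn[OF r c] B.W_turn[OF r c]
          W[of "Suc c"] eq c by (metis Suc_le_mono atLeastAtMost_iff le_SucI)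
    qed
  qed
  have "p \<in> P \<longleftrightarrow> p \<in> P'" for p
  proof (cases p)
    case (Pair r c)
    show ?thesis
    proof (cases "r \<in> {1..n} \<and> c \<in> {1..n - r}")
      case True
      then show ?thesis using P T[of r] Pair by auto
    next
      case False
      then show ?thesis using A.P_cell B.P_cell Pair by blast
    qed
  qed
  then show ?thesis by blast
qed

section \<open>A linear extension determines where the pipes turn\<close>

section \<open>Pipe dreams and their linear extensions\<close>

definition below :: "nat \<Rightarrow> (nat \<Rightarrow> nat) \<Rightarrow> (nat \<Rightarrow> nat) \<Rightarrow> bool" where
  "below n q f \<longleftrightarrow> (\<forall>i\<in>{1..n}. \<forall>j\<in>{1..n}. i < j \<longrightarrow> q i < q j \<longrightarrow> f i < f j)"

text \<open>
  The closed form, obtained by iterating \<open>card_right_step\<close> from the top row, of the statement that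
  pipe \<open>j > r\<close> turns north in row \<open>r\<close>.
\<close>

definition turning :: "nat \<Rightarrow> (nat \<Rightarrow> nat) \<Rightarrow> (nat \<Rightarrow> nat) \<Rightarrow> nat \<Rightarrow> nat \<Rightarrow> bool" where
  "turning n q f r j \<longleftrightarrow> f r < f j \<and>
    card {u \<in> {1..n}. f u < f j \<and> q j < q u} \<le> card {u \<in> {1..<r}. f u < f j}"

context pipe_rows
begin

lemma T_Suc_range:
  assumes "c \<in> {1..n - r}"
  shows "T (Suc r) c \<in> {Suc r..n}"
proof (rule T_range)
  show "Suc r \<in> {1..n}" "c \<in> {1..Suc n - Suc r}" using assms by auto
qed

lemma W_range':
  assumes "r \<in> {1..n}" "c \<in> {1..n - r}"
  shows "W r c \<in> {r..n}"
proof (rule W_range)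
  show "r \<in> {1..n}" "c \<in> {1..Suc n - r}" using assms by auto
qed

lemma contact_arc:
  assumes "\<pi> \<in> linear_extensions n P" "r \<in> {1..n}" "c \<in> {1..n - r}" "(r, c) \<notin> P"
  shows "inv \<pi> (W r c) < inv \<pi> (T (Suc r) c)"
proof -
  have W: "W r c \<in> {1..n}" using W_range'[of r c] assms by auto
  have T: "T (Suc r) c \<in> {1..n}" using T_Suc_range[of c r] assms by auto
  have "(W r c, (r, c), T (Suc r) c) \<in> arcs (contact_graph n P)"
    using W T assms enters_West_iff[OF W] enters_South_iff[OF T]
    by (auto simp: contact_graph_def contacts_def inner_cells_def)
  then show ?thesis using assms(1)
    by (fastforce simp: linear_extensions_def contact_graph_def)
qed

lemma linear_extensionI:
  assumes "\<pi> permutes {1..n}"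
    and "\<And>r c. r \<in> {1..n} \<Longrightarrow> c \<in> {1..n - r} \<Longrightarrow> (r, c) \<notin> P \<Longrightarrow> inv \<pi> (W r c) < inv \<pi> (T (Suc r) c)"
  shows "\<pi> \<in> linear_extensions n P"
proof -
  have "inv \<pi> i < inv \<pi> j" if "i \<in> {1..n}" "j \<in> {1..n}" "(r, c) \<in> contacts n P"
    "enters P i (r, c) West" "enters P j (r, c) South" for i j r c
    using that assms(2)[of r c] enters_West_iff[of i] enters_South_iff[of j]
    by (auto simp: contacts_def inner_cells_def)
  then show ?thesis using assms(1) by (auto simp: linear_extensions_def contact_graph_def)
qed

definition cross_from :: "nat \<Rightarrow> nat \<Rightarrow> nat \<Rightarrow> bool" where
  "cross_from r i j \<longleftrightarrow> (\<exists>x c. r \<le> x \<and> (x, c) \<in> P \<and>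
    (W x c = i \<and> T (Suc x) c = j \<or> W x c = j \<and> T (Suc x) c = i))"

lemma pipes_cross_at_iff:
  assumes "i \<in> {1..n}" "j \<in> {1..n}"
  shows "pipes_cross_at P i j (r, c) \<longleftrightarrow> (r, c) \<in> P \<and>
    (W r c = i \<and> T (Suc r) c = j \<or> W r c = j \<and> T (Suc r) c = i)"
  using assms P_cell[of r c]
  by (auto simp: pipes_cross_at_def enters_West_iff enters_South_iff)

lemma exits_at_iff:
  assumes "j \<in> {1..n}"
  shows "exits_at P j c \<longleftrightarrow> c \<in> {1..n} \<and> T 1 c = j"
  using assms by (auto simp: exits_at_def enters_South_iff)

lemma reduced_row:
  assumes dream: "pipe_dream n P" and ext: "\<pi> \<in> linear_extensions n P" and r: "r \<in> {1..n}"
    and resp: "\<And>c d. 1 \<le> c \<Longrightarrow> c < d \<Longrightarrow> d \<le> n - r \<Longrightarrow> T (Suc r) c < T (Suc r) d \<Longrightarrow>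
      inv \<pi> (T (Suc r) c) < inv \<pi> (T (Suc r) d)"
    and cross: "\<And>c d. 1 \<le> c \<Longrightarrow> c < d \<Longrightarrow> d \<le> n - r \<Longrightarrow> T (Suc r) d < T (Suc r) c \<Longrightarrow>
      cross_from (Suc r) (T (Suc r) c) (T (Suc r) d)"
  shows "reduced_pipe_row (n - r) r (crossing_columns r) (T (Suc r)) (W r) (T r) (inv \<pi>)
    (cross_from (Suc r))"
proof -
  interpret pipe_row "n - r" r "crossing_columns r" "T (Suc r)" "W r" "T r" by (rule row[OF r])
  have "\<pi> permutes {1..n}" using ext by (simp add: linear_extensions_def)
  then have inj: "inj (inv \<pi>)" by (meson permutes_inj permutes_inv)
  show ?thesis
  proof unfold_locales
    fix c assume "c \<in> {1..n - r}"
    then show "r < T (Suc r) c" using T_Suc_range[of c r] by auto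
  next
    fix c assume "c \<in> {1..n - r}" "c \<notin> crossing_columns r"
    then show "inv \<pi> (W r c) < inv \<pi> (T (Suc r) c)" using contact_arc[OF ext r] by auto
  next
    fix c assume "c \<in> crossing_columns r"
    then have c: "(r, c) \<in> P" by simp
    show "\<not> cross_from (Suc r) (W r c) (T (Suc r) c)"
    proof
      assume "cross_from (Suc r) (W r c) (T (Suc r) c)"
      then obtain x d where x: "Suc r \<le> x" "(x, d) \<in> P"
        "W x d = W r c \<and> T (Suc x) d = T (Suc r) c \<or> W x d = T (Suc r) c \<and> T (Suc x) d = W r c"
        unfolding cross_from_def by blast
      have 1: "W r c \<in> {1..n}" using W_range'[of r c] P_cell[OF c] by auto
      have 2: "T (Suc r) c \<in> {1..n}" using T_Suc_range[of c r] P_cell[OF c] by auto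
      have "pipes_cross_at P (W r c) (T (Suc r) c) (r, c)"
        "pipes_cross_at P (W r c) (T (Suc r) c) (x, d)"
        using pipes_cross_at_iff[OF 1 2] c x by auto
      then have "(r, c) = (x, d)" using dream 1 2 unfolding pipe_dream_def by blast
      then show False using x by simp
    qed
  qed (use inj resp cross in auto)
qed

text \<open>The invariant climbs from the empty word below row \<open>n\<close>. At
  \<open>r = 1\<close>, where the word is \<omega>, its first half says that every linear extension
  lies below \<omega> in the weak order.\<close>

lemma rows_reduced:
  assumes dream: "pipe_dream n P" and ext: "\<pi> \<in> linear_extensions n P"
    and r: "1 \<le> r" "r \<le> Suc n"
  shows "(\<forall>c d. 1 \<le> c \<longrightarrow> c < d \<longrightarrow> d \<le> Suc n - r \<longrightarrow> T r c < T r d \<longrightarrow>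
      inv \<pi> (T r c) < inv \<pi> (T r d)) \<and>
    (\<forall>c d. 1 \<le> c \<longrightarrow> c < d \<longrightarrow> d \<le> Suc n - r \<longrightarrow> T r d < T r c \<longrightarrow> cross_from r (T r c) (T r d))"
  using r(2,1)
proof (induction rule: inc_induct)
  case base
  then show ?case by simp
next
  case (step r)
  then have r: "r \<in> {1..n}" by auto
  note IH = step.IH[OF le_SucI, OF step.prems]
  interpret reduced_pipe_row "n - r" r "crossing_columns r" "T (Suc r)" "W r" "T r" "inv \<pi>"
    "cross_from (Suc r)"
    by (rule reduced_row[OF dream ext r]) (use IH in auto)
  have "cross_from r (T r c) (T r d)"
    if "1 \<le> c" "c < d" "d \<le> Suc (n - r)" "T r d < T r c" for c d
    using crossed_t[OF that]
  proof
    assume "cross_from (Suc r) (T r c) (T r d)"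
    then show ?thesis unfolding cross_from_def by (meson Suc_leD)
  next
    assume "\<exists>e\<in>crossing_columns r. T r d = W r e \<and> T r c = T (Suc r) e"
    then show ?thesis unfolding cross_from_def by (metis le_refl mem_Collect_eq)
  qed
  then show ?case using resp_t r by (simp add: Suc_diff_le)
qed

lemma rows_ordered:
  assumes dream: "pipe_dream n P" and ext: "\<pi> \<in> linear_extensions n P" and r: "r \<in> {1..n}"
  shows "ordered_pipe_row (n - r) r (crossing_columns r) (T (Suc r)) (W r) (T r) (inv \<pi>)"
proof -
  note IH = rows_reduced[OF dream ext, of "Suc r"]
  interpret reduced_pipe_row "n - r" r "crossing_columns r" "T (Suc r)" "W r" "T r" "inv \<pi>"
    "cross_from (Suc r)"
    by (rule reduced_row[OF dream ext r]) (use IH r in auto)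
  show ?thesis by (rule is_ordered)
qed

lemma turn_iff_turning:
  assumes ord: "\<And>r. r \<in> {1..n} \<Longrightarrow>
      ordered_pipe_row (n - r) r (crossing_columns r) (T (Suc r)) (W r) (T r) f"
    and q: "\<And>c. c \<in> {1..n} \<Longrightarrow> q (T 1 c) = c"
    and r: "r \<in> {1..n}" and c: "c \<in> {1..Suc n - r}" and ne: "T r c \<noteq> r"
  shows "(r, c) \<notin> P \<longleftrightarrow> turning n q f r (T r c)"
proof -
  define k where "k j = card {u \<in> {1..n}. f u < f j \<and> q j < q u}" for j
  define b where "b r j = card {u \<in> {1..<r}. f u < f j}" for r j
  have top: "card {u \<in> T 1 ` {c<..n}. f u < f (T 1 c)} = k (T 1 c)" if c: "c \<in> {1..n}" for c
  proof -
    have "u \<in> T 1 ` {c<..n} \<longleftrightarrow> u \<in> {1..n} \<and> q (T 1 c) < q u" for u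
    proof
      assume "u \<in> T 1 ` {c<..n}"
      then obtain d where d: "d \<in> {c<..n}" "u = T 1 d" by auto
      then have "u \<in> {1..n}" using T_range[of 1 d] by auto
      then show "u \<in> {1..n} \<and> q (T 1 c) < q u" using d q[of d] q[of c] c by auto
    next
      assume u: "u \<in> {1..n} \<and> q (T 1 c) < q u"
      then obtain d where "d \<in> {1..n}" "u = T 1 d" using T_surj[of 1 u] by auto
      then show "u \<in> T 1 ` {c<..n}" using u q[of d] q[of c] c by auto
    qed
    then have "{u \<in> T 1 ` {c<..n}. f u < f (T 1 c)} = {u \<in> {1..n}. f u < f (T 1 c) \<and> q (T 1 c) < q u}"
      by blast
    then show ?thesis by (simp add: k_def)
  qed
  \<comment> \<open>By \<open>card_right_step\<close>, passing below row \<open>r\<close> lowers the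
    count of pipe \<open>j\<close> by one exactly when \<open>r\<close> precedes \<open>j\<close>.
    The truncated subtractions add up: \<open>k - x - y = k - (x + y)\<close>.\<close>
  have count: "\<forall>c \<in> {1..Suc n - r}. card {u \<in> T r ` {c<..Suc n - r}. f u < f (T r c)} =
    k (T r c) - b r (T r c)" if "1 \<le> r" "r \<le> n" for r
    using that
  proof (induction rule: dec_induct)
    case base
    then show ?case using top by (simp add: b_def)
  next
    case (step r)
    then have r: "r \<in> {1..n}" by auto
    have Tr: "card {u \<in> T r ` {c<..Suc n - r}. f u < f (T r c)} = k (T r c) - b r (T r c)"
      if "c \<in> {1..Suc n - r}" for c
      using step.IH step.prems that by simp
    interpret ordered_pipe_row "n - r" r "crossing_columns r" "T (Suc r)" "W r" "T r" f
      by (rule ord[OF r])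
    show ?case
    proof
      fix e assume e: "e \<in> {1..Suc n - Suc r}"
      then have "T (Suc r) e \<in> {Suc r..n}" using T_range[of "Suc r" e] by auto
      then obtain c where c: "c \<in> {1..Suc n - r}" "T r c = T (Suc r) e" "T r c \<noteq> r"
        using T_surj[OF r, of "T (Suc r) e"] by auto
      have c': "c \<in> {1..Suc (n - r)}" using c r by auto
      obtain e' where e': "e' \<in> {1..n - r}" "T (Suc r) e' = T r c"
        "card {u \<in> T (Suc r) ` {e'<..n - r}. f u < f (T r c)} =
          card {u \<in> T r ` {c<..Suc (n - r)}. f u < f (T r c)} - (if f r < f (T r c) then 1 else 0)"
        using card_right_step[OF c' c(3)] by blast
      have "e' = e" using e' e c inj_onD[OF inj_s, of e' e] by auto
      have "{1..<Suc r} = insert r {1..<r}" using r by auto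
      then have "{u \<in> {1..<Suc r}. f u < f (T r c)} = (if f r < f (T r c)
        then insert r {u \<in> {1..<r}. f u < f (T r c)} else {u \<in> {1..<r}. f u < f (T r c)})"
        by auto
      then have "b (Suc r) (T r c) = b r (T r c) + (if f r < f (T r c) then 1 else 0)"
        by (simp add: b_def)
      then show "card {u \<in> T (Suc r) ` {e<..Suc n - Suc r}. f u < f (T (Suc r) e)} =
          k (T (Suc r) e) - b (Suc r) (T (Suc r) e)"
        using e'(3) Tr[OF c(1)] r unfolding \<open>e' = e\<close> c(2)[symmetric] by (simp add: Suc_diff_le)
    qed
  qed
  interpret ordered_pipe_row "n - r" r "crossing_columns r" "T (Suc r)" "W r" "T r" f
    by (rule ord[OF r])
  have eq: "Suc (n - r) = Suc n - r" using r by auto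
  have fin: "finite {u \<in> T r ` {c<..Suc n - r}. f u < f (T r c)}" by simp
  have "(r, c) \<notin> P \<longleftrightarrow> f r \<le> f (T r c) \<and> {u \<in> T r ` {c<..Suc n - r}. f u < f (T r c)} = {}"
    using turn_iff[of c] c eq by simp
  also have "\<dots> \<longleftrightarrow> f r < f (T r c) \<and> k (T r c) - b r (T r c) = 0"
    using count[of r] r c ne inj_f fin card_0_eq[OF fin]
    by (metis (no_types, lifting) atLeastAtMost_iff injD nat_less_le)
  also have "\<dots> \<longleftrightarrow> turning n q f r (T r c)" by (simp add: turning_def k_def b_def)
  finally show ?thesis .
qed

end

section \<open>Existence: a pipe dream for every element of the interval\<close>

section \<open>Inserting a permutation\<close>

text \<open>
  The row whose word of outgoing pipes is \<open>t\<close> has its contacts at the right-to-left minima of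
  \<open>f \<circ> t\<close> from the column of pipe \<open>r\<close> onwards.
\<close>

definition row_crossings :: "(nat \<Rightarrow> nat) \<Rightarrow> nat \<Rightarrow> nat \<Rightarrow> (nat \<Rightarrow> nat) \<Rightarrow> nat set" where
  "row_crossings f m r t =
    {c \<in> {1..m}. \<not> (f r \<le> f (t c) \<and> (\<forall>d\<in>{c<..Suc m}. f (t c) < f (t d)))}"

definition next_turn :: "nat set \<Rightarrow> nat \<Rightarrow> nat" where
  "next_turn K c = (LEAST d. c \<le> d \<and> d \<notin> K)"

text \<open>Recovers the word below a row from the word above it. The south pipe of a contact turns
  east and leaves the row at the next contact, or at the elbow.\<close>

definition row_south :: "nat set \<Rightarrow> (nat \<Rightarrow> nat) \<Rightarrow> nat \<Rightarrow> nat" where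
  "row_south K t c = (if c \<in> K then t c else t (next_turn K (Suc c)))"

lemma next_turn:
  assumes "K \<subseteq> {1..m}" "c \<le> Suc m"
  shows "c \<le> next_turn K c" "next_turn K c \<le> Suc m" "next_turn K c \<notin> K"
proof -
  have ex: "c \<le> Suc m \<and> Suc m \<notin> K" using assms by auto
  then show "next_turn K c \<le> Suc m" unfolding next_turn_def by (rule Least_le)
  show "c \<le> next_turn K c" "next_turn K c \<notin> K"
    using LeastI[of "\<lambda>d. c \<le> d \<and> d \<notin> K", OF ex] by (auto simp: next_turn_def)
qed

lemma next_turn_le: "c \<le> d \<Longrightarrow> d \<notin> K \<Longrightarrow> next_turn K c \<le> d"
  unfolding next_turn_def by (rule Least_le) simp

lemma next_turn_self: "c \<notin> K \<Longrightarrow> next_turn K c = c"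
  unfolding next_turn_def by (rule Least_equality) auto

lemma next_turn_Suc: "c \<in> K \<Longrightarrow> next_turn K c = next_turn K (Suc c)"
  unfolding next_turn_def by (metis (no_types, opaque_lifting) Suc_leD Suc_leI le_neq_implies_less)

locale insertion_row =
  fixes m r :: nat and f t :: "nat \<Rightarrow> nat"
  assumes inj_f: "inj f"
    and inj_t: "inj_on t {1..Suc m}"
    and r_in: "r \<in> t ` {1..Suc m}"
    and r_le: "\<And>c. c \<in> {1..Suc m} \<Longrightarrow> r \<le> t c"
    and resp_t: "\<And>c d. 1 \<le> c \<Longrightarrow> c < d \<Longrightarrow> d \<le> Suc m \<Longrightarrow> t c < t d \<Longrightarrow> f (t c) < f (t d)"
begin

abbreviation K where "K \<equiv> row_crossings f m r t"
abbreviation w where "w c \<equiv> t (next_turn K c)"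
abbreviation s where "s \<equiv> row_south K t"

lemma K_sub: "K \<subseteq> {1..m}"
  by (auto simp: row_crossings_def)

lemma turn_first: "c \<in> {1..m} \<Longrightarrow> c \<notin> K \<Longrightarrow> d \<in> {c<..Suc m} \<Longrightarrow> f (t c) < f (t d)"
  by (auto simp: row_crossings_def)

lemma turn_after: "c \<in> {1..m} \<Longrightarrow> c \<notin> K \<Longrightarrow> f r \<le> f (t c)"
  by (auto simp: row_crossings_def)

definition c0 where "c0 = (SOME c. c \<in> {1..Suc m} \<and> t c = r)"

lemma c0: "c0 \<in> {1..Suc m}" "t c0 = r"
  using someI_ex[of "\<lambda>c. c \<in> {1..Suc m} \<and> t c = r"] r_in unfolding c0_def by blast+

lemma t_eq_r: "c \<in> {1..Suc m} \<Longrightarrow> t c = r \<Longrightarrow> c = c0"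
  using inj_onD[OF inj_t] c0 by metis

lemma after_c0: "c0 < c \<Longrightarrow> c \<le> Suc m \<Longrightarrow> f r < f (t c)"
  using resp_t[of c0 c] r_le[of c] t_eq_r[of c] c0 by (cases "t c = r") auto

lemma c0_notin: "c0 \<notin> K"
  using after_c0 c0 by (auto simp: row_crossings_def)

text \<open>By the two conditions on contacts, a contact left of \<open>c0\<close> would be left by
  a pipe that is not earlier than \<open>r\<close> and yet earlier than the pipe \<open>r\<close> to
  its right.\<close>

lemma before_c0: "1 \<le> c \<Longrightarrow> c < c0 \<Longrightarrow> c \<in> K"
  using turn_first[of c c0] turn_after[of c] c0 by fastforce

lemma next_before_c0:
  assumes "1 \<le> c" "c \<le> c0"
  shows "next_turn K c = c0"
proof (rule antisym)
  show "next_turn K c \<le> c0" using next_turn_le c0_notin assms by blast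
  show "c0 \<le> next_turn K c"
  proof (rule ccontr)
    assume "\<not> c0 \<le> next_turn K c"
    then show False
      using next_turn[OF K_sub, of c] assms c0 before_c0[of "next_turn K c"] by auto
  qed
qed

sublocale pipe_cells m r K s w t
proof
  show "w (Suc 0) = r" using next_before_c0[of 1] c0 by simp
  have "Suc m \<notin> K" using K_sub by auto
  then show "t (Suc m) = w (Suc m)" by (simp add: next_turn_self)
qed (use K_sub next_turn_Suc in \<open>auto simp: row_south_def next_turn_self\<close>)

sublocale pipe_row m r K s w t
proof
  \<comment> \<open>The \<open>m + 1\<close> distinct outgoing pipes are \<open>r\<close> and the
    \<open>m\<close> south pipes; by counting, the latter are distinct and avoid
    \<open>r\<close>.\<close>
  have im: "t ` {1..Suc m} = insert r (s ` {1..m})" using t_image[of 1] w_first by simp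
  have "card (t ` {1..Suc m}) = Suc m" using inj_t by (simp add: card_image)
  then have card: "card (insert r (s ` {1..m})) = Suc m" using im by simp
  have le: "card (s ` {1..m}) \<le> m" using card_image_le[of "{1..m}" s] by simp
  show r: "r \<notin> s ` {1..m}"
  proof
    assume "r \<in> s ` {1..m}"
    then have "card (s ` {1..m}) = Suc m" using card by (simp add: insert_absorb)
    then show False using le by simp
  qed
  then have "card (s ` {1..m}) = card {1..m}" using card by simp
  then show "inj_on s {1..m}" by (intro eq_card_imp_inj_on) auto
qed

lemma K_smaller:
  assumes "c \<in> K" "f r \<le> f (t c)"
  shows "\<exists>d\<in>{c<..Suc m}. f (t d) < f (t c)"
proof -
  obtain d where d: "d \<in> {c<..Suc m}" "\<not> f (t c) < f (t d)"
    using assms by (auto simp: row_crossings_def)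
  then have "t c \<noteq> t d" using inj_onD[OF inj_t, of c d] K_sub assms by auto
  then show ?thesis using d inj_f by (metis injD linorder_neqE_nat)
qed

sublocale ordered_pipe_row m r K s w t f
proof
  fix c assume c: "c \<in> {1..m}" and turn: "c \<notin> K \<or> w c \<noteq> r"
  show "f (w c) < f (s c)"
  proof (cases "c \<in> K")
    case False
    then show ?thesis
      using next_turn[OF K_sub, of "Suc c"] c
      by (auto simp: row_crossings_def row_south_def next_turn_self)
  next
    case True
    then have "\<not> c \<le> c0" using turn next_before_c0[of c] c0 c by auto
    then have "f r < f (t c)" using after_c0 c by auto
    then obtain d where d: "d \<in> {c<..Suc m}" "f (t d) < f (t c)"
      using K_smaller[OF True] by fastforce
    \<comment> \<open>The earliest pipe to the right of \<open>c\<close> has nothing earlier to its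
      own right, so it leaves at a contact or at the elbow. The first turn after \<open>c\<close> is
      at or before \<open>e\<close>, and its pipe \<open>w c\<close> is no later than that of
      \<open>e\<close>.\<close>
    obtain e where e: "e \<in> {c<..Suc m}" "\<And>d. d \<in> {c<..Suc m} \<Longrightarrow> f (t e) \<le> f (t d)"
    proof -
      obtain e where "is_arg_min (\<lambda>d. f (t d)) (\<lambda>d. d \<in> {c<..Suc m}) e"
        using ex_is_arg_min_if_finite[of "{c<..Suc m}" "\<lambda>d. f (t d)"] d by blast
      then show ?thesis using that by (auto simp: is_arg_min_linorder)
    qed
    have "f r < f (t e)" using after_c0[of e] e \<open>\<not> c \<le> c0\<close> by auto
    have "e \<notin> K"
    proof
      assume "e \<in> K"
      then obtain d where "d \<in> {e<..Suc m}" "f (t d) < f (t e)"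
        using K_smaller[of e] \<open>f r < f (t e)\<close> by auto
      then show False using e(1) e(2)[of d] by auto
    qed
    then have ne: "next_turn K c \<le> e" using next_turn_le e by simp
    have "c \<noteq> next_turn K c" using next_turn[OF K_sub, of c] True c by auto
    then have nc: "c < next_turn K c" using next_turn[OF K_sub, of c] c by auto
    have "f (t (next_turn K c)) \<le> f (t e)"
    proof (cases "next_turn K c = e")
      case False
      then have "next_turn K c \<in> {1..m}" "next_turn K c \<notin> K" "e \<in> {next_turn K c<..Suc m}"
        using ne nc c e next_turn[OF K_sub, of c] by auto
      then show ?thesis using turn_first less_imp_le by blast
    qed simp
    also have "\<dots> \<le> f (t d)" using e d by blast
    also have "\<dots> < f (s c)" using d True by (simp add: row_south_def)
    finally show ?thesis .
  qed
qed (rule inj_f)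

text \<open>Above the row \<open>w c\<close> stands to the right of \<open>t c\<close> although it
  is earlier in \<open>f\<close>; \<open>resp_t\<close> excludes this for an increasing
  pair.\<close>

lemma cross_less:
  assumes "c \<in> K"
  shows "w c < s c"
proof -
  have c: "c \<in> {1..m}" using assms K_sub by blast
  have sc: "s c = t c" using assms by (simp add: row_south_def)
  show ?thesis
  proof (cases "w c = r")
    case True
    then show ?thesis using r_le[of c] c s_ne_r[OF c] sc by auto
  next
    case False
    then have lt: "f (w c) < f (t c)" using prec[OF c] sc by simp
    moreover have "c \<noteq> next_turn K c" using next_turn[OF K_sub, of c] assms c by auto
    ultimately have "\<not> t c < w c" using resp_t[of c "next_turn K c"] next_turn[OF K_sub, of c] c by auto
    moreover have "t c \<noteq> w c" using lt by auto
    ultimately show ?thesis using sc by simp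
  qed
qed

lemma resp_s:
  assumes "1 \<le> c" "c < d" "d \<le> m" "s c < s d"
  shows "f (s c) < f (s d)"
proof (cases "c \<in> K")
  case True
  then have sc: "s c = t c" by (simp add: row_south_def)
  have "s d \<in> t ` {d..Suc m}" using t_image[of d] assms by auto
  then obtain e where "d \<le> e" "e \<le> Suc m" "s d = t e" by auto
  then show ?thesis using resp_t[of c e] assms sc by simp
next
  case False
  then have sc: "s c = w (Suc c)" by (simp add: row_south_def)
  then have ne: "w (Suc c) \<noteq> r" using s_ne_r[of c] assms by simp
  have "s d \<in> t ` {Suc c..Suc m}" using t_image[of "Suc c"] assms by auto
  then obtain e where "Suc c \<le> e" "e \<le> Suc m" "s d = t e" by auto
  then have "f (s c) \<le> f (s d)" using w_le_t[of "Suc c" e] ne sc by simp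
  moreover have "f (s c) \<noteq> f (s d)" using assms inj_f by (metis injD less_irrefl)
  ultimately show ?thesis by simp
qed

text \<open>The danger is that the larger pipe \<open>s c\<close> turns east and overtakes the
  smaller one. If it gets as far as \<open>d\<close>, it meets \<open>s d\<close> there from the
  west; as a west pipe is smaller at a crossing, the cell is a contact, where \<open>s c\<close>
  leaves north and \<open>s d\<close> moves on to the right.\<close>

lemma inversion_kept:
  assumes "1 \<le> c" "c < d" "d \<le> m" "s d < s c"
  obtains c' d' where "1 \<le> c'" "c' < d'" "d' \<le> Suc m" "t c' = s c" "t d' = s d"
proof -
  have "s d \<in> t ` {d..Suc m}" using t_image[of d] assms by auto
  then obtain d' where d': "d \<le> d'" "d' \<le> Suc m" "t d' = s d" by auto
  show ?thesis
  proof (cases "c \<in> K")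
    case True
    then show ?thesis using that[of c d'] d' assms by (simp add: row_south_def)
  next
    case False
    define e where "e = next_turn K (Suc c)"
    have e: "Suc c \<le> e" "e \<le> Suc m" "e \<notin> K" "t e = s c"
      using next_turn[OF K_sub, of "Suc c"] assms False by (auto simp: e_def row_south_def)
    have "e < d'"
    proof (cases "e < d")
      case False
      then have "{Suc c..<d} \<subseteq> K" using next_turn_le[of "Suc c" _ K] unfolding e_def by fastforce
      then have "w d = s c" using w_carried[of "Suc c" d] assms e e_def by simp
      then have "d \<notin> K" using cross_less[of d] assms by auto
      then have "t d = s c" using \<open>w d = s c\<close> by (simp add: next_turn_self)
      then have "e = d" using inj_onD[OF inj_t, of e d] e assms by auto
      moreover have "d' \<noteq> d" using d' \<open>t d = s c\<close> assms by auto
      ultimately show ?thesis using d' by simp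
    qed (use d' in simp)
    then show ?thesis using that[of e d'] e d' assms by simp
  qed
qed

end

text \<open>Index \<open>k\<close> is the word below row \<open>k\<close>, so index 0 is the top
  border; \<open>T r\<close> shifts the index to name the word above row \<open>r\<close>.\<close>

primrec insertion_words :: "nat \<Rightarrow> (nat \<Rightarrow> nat) \<Rightarrow> (nat \<Rightarrow> nat) \<Rightarrow> nat \<Rightarrow> nat \<Rightarrow> nat" where
  "insertion_words n f \<omega> 0 = \<omega>"
| "insertion_words n f \<omega> (Suc k) =
    row_south (row_crossings f (n - Suc k) (Suc k) (insertion_words n f \<omega> k)) (insertion_words n f \<omega> k)"

locale insertion =
  fixes n :: nat and \<omega> f :: "nat \<Rightarrow> nat"
  assumes \<omega>: "\<omega> permutes {1..n}" and f: "f permutes {1..n}" and b: "below n (inv \<omega>) f"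
begin

definition T where "T r = insertion_words n f \<omega> (r - 1)"
definition P where "P = {(r, c). r \<in> {1..n} \<and> c \<in> row_crossings f (n - r) r (T r)}"
definition W where "W r c = T r (next_turn {c. (r, c) \<in> P} c)"

lemma T_Suc: "r \<ge> 1 \<Longrightarrow> T (Suc r) = row_south (row_crossings f (n - r) r (T r)) (T r)"
  by (cases r) (auto simp: T_def)

text \<open>The second clause lets the insertion continue with the next row. For row 1 it is the
  hypothesis \<open>b\<close> that the permutation lies below \<omega>.\<close>

lemma rows:
  assumes "1 \<le> r" "r \<le> Suc n"
  shows "T r ` {1..Suc n - r} = {r..n} \<and>
    (\<forall>c d. 1 \<le> c \<longrightarrow> c < d \<longrightarrow> d \<le> Suc n - r \<longrightarrow> T r c < T r d \<longrightarrow> f (T r c) < f (T r d)) \<and>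
    (r \<le> n \<longrightarrow> insertion_row (n - r) r f (T r))"
  using assms
proof (induction rule: dec_induct)
  have inj: "inj f" using f by (rule permutes_inj)
  have mk: "insertion_row (n - r) r f (T r)"
    if im: "T r ` {1..Suc n - r} = {r..n}" and r: "1 \<le> r" "r \<le> n"
      and resp: "\<forall>c d. 1 \<le> c \<longrightarrow> c < d \<longrightarrow> d \<le> Suc n - r \<longrightarrow> T r c < T r d \<longrightarrow> f (T r c) < f (T r d)" for r
  proof
    have eq: "Suc n - r = Suc (n - r)" using r by simp
    show "inj_on (T r) {1..Suc (n - r)}"
    proof (rule eq_card_imp_inj_on)
      show "card (T r ` {1..Suc (n - r)}) = card {1..Suc (n - r)}" using im r unfolding eq by simp
    qed simp
    show "r \<in> T r ` {1..Suc (n - r)}" using im r unfolding eq by simp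
    show "r \<le> T r c" if "c \<in> {1..Suc (n - r)}" for c
      using im that unfolding eq by (metis atLeastAtMost_iff imageI)
  qed (use inj resp r in \<open>auto simp: Suc_diff_le\<close>)
  {
    case base
    have T1: "T 1 = \<omega>" "T (Suc 0) = \<omega>" by (simp_all add: T_def)
    have im: "T 1 ` {1..Suc n - 1} = {1..n}" using permutes_image[OF \<omega>] T1 by simp
    moreover have resp: "\<forall>c d. 1 \<le> c \<longrightarrow> c < d \<longrightarrow> d \<le> Suc n - 1 \<longrightarrow> T 1 c < T 1 d \<longrightarrow> f (T 1 c) < f (T 1 d)"
    proof (intro allI impI)
      fix c d :: nat assume "1 \<le> c" "c < d" "d \<le> Suc n - 1" "T 1 c < T 1 d"
      moreover from this have "\<omega> c \<in> {1..n}" "\<omega> d \<in> {1..n}"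
        using permutes_in_image[OF \<omega>, of c] permutes_in_image[OF \<omega>, of d] by auto
      ultimately show "f (T 1 c) < f (T 1 d)"
        using b permutes_inverses(2)[OF \<omega>] by (simp add: T1 below_def)
    qed
    ultimately show ?case using mk[of 1] by simp
  next
    case (step r)
    then have r: "1 \<le> r" "r \<le> n" by auto
    then interpret insertion_row "n - r" r f "T r" using step by auto
    have eq: "Suc n - r = Suc (n - r)" "Suc n - Suc r = n - r" using r by auto
    have s: "T (Suc r) = s" using T_Suc r by simp
    have "insert r (s ` {1..n - r}) = {r..n}" using t_image[of 1] w_first step r unfolding eq by simp
    then have "s ` {1..n - r} = {r..n} - {r}" using r_notin by blast
    also have "\<dots> = {Suc r..n}" by auto
    finally have im: "T (Suc r) ` {1..Suc n - Suc r} = {Suc r..n}" unfolding s eq .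
    moreover have "\<forall>c d. 1 \<le> c \<longrightarrow> c < d \<longrightarrow> d \<le> Suc n - Suc r \<longrightarrow> T (Suc r) c < T (Suc r) d \<longrightarrow>
        f (T (Suc r) c) < f (T (Suc r) d)"
      using resp_s unfolding s eq by blast
    ultimately show ?case using mk[of "Suc r"] by simp
  }
qed

lemma P_row: "r \<in> {1..n} \<Longrightarrow> {c. (r, c) \<in> P} = row_crossings f (n - r) r (T r)"
  by (auto simp: P_def)

lemma ins_row: "r \<in> {1..n} \<Longrightarrow> insertion_row (n - r) r f (T r)"
  using rows[of r] by auto

sublocale pipe_rows n P T W
proof
  show "P \<subseteq> inner_cells n" by (auto simp: P_def inner_cells_def row_crossings_def)
next
  fix r assume r: "r \<in> {1..n}"
  interpret insertion_row "n - r" r f "T r" by (rule ins_row[OF r])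
  note eqs = P_row[OF r] W_def T_Suc[of r]
  show "W r (Suc 0) = r" using w_first unfolding eqs .
  show "T r (Suc (n - r)) = W r (Suc (n - r))" using t_last unfolding eqs .
  fix c assume c: "c \<in> {1..n - r}"
  have iff: "(r, c) \<in> P \<longleftrightarrow> c \<in> K" using P_row[OF r] by auto
  have s: "T (Suc r) = s" using T_Suc r by simp
  show "(r, c) \<in> P \<Longrightarrow> W r (Suc c) = W r c" using w_cross[OF c] unfolding iff eqs .
  show "(r, c) \<in> P \<Longrightarrow> T r c = T (Suc r) c" using t_cross[OF c] unfolding iff s .
  show "(r, c) \<notin> P \<Longrightarrow> W r (Suc c) = T (Suc r) c" using w_turn[OF c] unfolding iff W_def P_row[OF r] s .
  show "(r, c) \<notin> P \<Longrightarrow> T r c = W r c" using t_turn[OF c] unfolding iff W_def P_row[OF r] .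
qed

lemma west_less_south:
  assumes "(r, c) \<in> P"
  shows "W r c < T (Suc r) c"
proof -
  have r: "r \<in> {1..n}" using P_cell assms by blast
  interpret insertion_row "n - r" r f "T r" by (rule ins_row[OF r])
  show ?thesis using cross_less[of c] assms P_row[OF r] T_Suc[of r] r by (auto simp: W_def)
qed

definition inverted_at :: "nat \<Rightarrow> nat \<Rightarrow> nat \<Rightarrow> bool" where
  "inverted_at r a b \<longleftrightarrow> b < a \<and> (\<exists>c d. 1 \<le> c \<and> c < d \<and> d \<le> Suc n - r \<and> T r c = a \<and> T r d = b)"

lemma inverted_up:
  assumes "1 \<le> r'" "r' \<le> r" "r \<le> n" "inverted_at r a b"
  shows "inverted_at r' a b"
  using assms(2,1)
proof (induction rule: inc_induct)
  case base
  then show ?case using assms by simp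
next
  case (step r')
  then have r: "r' \<in> {1..n}" using assms by auto
  interpret insertion_row "n - r'" r' f "T r'" by (rule ins_row[OF r])
  have s: "T (Suc r') = s" using T_Suc r by simp
  obtain c d where cd: "1 \<le> c" "c < d" "d \<le> n - r'" "s c = a" "s d = b" "b < a"
    using step unfolding inverted_at_def s by auto
  then obtain c' d' where "1 \<le> c'" "c' < d'" "d' \<le> Suc (n - r')" "T r' c' = s c" "T r' d' = s d"
    using inversion_kept[of c d] by auto
  then show ?case using cd r unfolding inverted_at_def by (auto simp: Suc_diff_le)
qed

text \<open>Above its crossing a pair has the larger pipe on the left, and this persists upwards. At
  a second crossing, in a higher row, the smaller pipe would come from the west, which
  \<open>w_notin\<close> forbids for a pipe entering from below to the right of that cell.\<close>

lemma cross_once: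
  assumes "(r, c) \<in> P" "(r', c') \<in> P" "W r c = W r' c'" "T (Suc r) c = T (Suc r') c'"
  shows "(r, c) = (r', c')"
proof -
  have aux: False if h: "(r, c) \<in> P" "(r', c') \<in> P" "W r c = W r' c'" "T (Suc r) c = T (Suc r') c'"
    "r' < r" for r c r' c'
  proof -
    note cells = P_cell[OF h(1)] P_cell[OF h(2)]
    interpret pipe_row "n - r" r "crossing_columns r" "T (Suc r)" "W r" "T r"
      using row cells by blast
    interpret r': pipe_row "n - r'" r' "crossing_columns r'" "T (Suc r')" "W r'" "T r'"
      using row cells by blast
    have "W r c \<in> T r ` {Suc c..Suc (n - r)}"
      using t_image[of "Suc c"] w_cross[of c] cells h by auto
    then obtain d where d: "Suc c \<le> d" "d \<le> Suc (n - r)" "T r d = W r c" by auto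
    moreover have "T r c = T (Suc r) c" using t_cross[of c] cells h by auto
    ultimately have "inverted_at r (T (Suc r) c) (W r c)"
      unfolding inverted_at_def using west_less_south[OF h(1)] cells
      by (intro conjI exI[of _ c] exI[of _ d]) auto
    then have "inverted_at (Suc r') (T (Suc r) c) (W r c)"
      using inverted_up[of "Suc r'" r] cells h(5) by auto
    then obtain x y where xy: "1 \<le> x" "x < y" "y \<le> n - r'" "T (Suc r') x = T (Suc r') c'" "T (Suc r') y = W r' c'"
      unfolding inverted_at_def using h by auto
    then have "x = c'" using inj_onD[OF r'.inj_s, of x c'] cells by auto
    then have "W r' c' \<in> T (Suc r') ` {c'..n - r'}" using xy by (metis atLeastAtMost_iff image_eqI less_imp_le)
    then show False using r'.w_notin[of c'] cells by auto
  qed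
  have "r = r'"
    using aux[of r c r' c'] aux[of r' c' r c] assms by (metis linorder_neqE_nat)
  moreover have "c = c'"
  proof -
    note cells = P_cell[OF assms(1)] P_cell[OF assms(2)]
    interpret pipe_row "n - r" r "crossing_columns r" "T (Suc r)" "W r" "T r"
      using row cells by blast
    show ?thesis using inj_onD[OF inj_s, of c c'] assms cells \<open>r = r'\<close> by auto
  qed
  ultimately show ?thesis by simp
qed

lemma pipe_dream: "pipe_dream n P"
  unfolding pipe_dream_def
proof (intro conjI ballI allI impI)
  fix i j p p' assume ij: "i \<in> {1..n}" "j \<in> {1..n}"
    and "pipes_cross_at P i j p \<and> pipes_cross_at P i j p'"
  moreover obtain r c r' c' where p: "p = (r, c)" "p' = (r', c')" by fastforce
  ultimately have cr: "(r, c) \<in> P" "W r c = i \<and> T (Suc r) c = j \<or> W r c = j \<and> T (Suc r) c = i"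
    "(r', c') \<in> P" "W r' c' = i \<and> T (Suc r') c' = j \<or> W r' c' = j \<and> T (Suc r') c' = i"
    using pipes_cross_at_iff[OF ij] by blast+
  then have "W r c = W r' c'" "T (Suc r) c = T (Suc r') c'"
    using west_less_south[OF cr(1)] west_less_south[OF cr(3)] by auto
  then show "p = p'" using cross_once cr p by blast
qed (rule P_subset)

lemma in_PD: "P \<in> PD n \<omega>"
proof -
  have "exits_at P j (inv \<omega> j)" if "j \<in> {1..n}" for j
    using that exits_at_iff[OF that] permutes_in_image[OF permutes_inv[OF \<omega>], of j]
      permutes_inverses(1)[OF \<omega>] by (simp add: T_def)
  then show ?thesis using pipe_dream by (simp add: PD_def)
qed

lemma is_linear_extension: "inv f \<in> linear_extensions n P"
proof (rule linear_extensionI)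
  show "inv f permutes {1..n}" using f by (rule permutes_inv)
  fix r c assume r: "r \<in> {1..n}" and c: "c \<in> {1..n - r}" and "(r, c) \<notin> P"
  interpret insertion_row "n - r" r f "T r" by (rule ins_row[OF r])
  have "c \<notin> K" using \<open>(r, c) \<notin> P\<close> P_row[OF r] by auto
  then show "inv (inv f) (W r c) < inv (inv f) (T (Suc r) c)"
    using prec[OF c] T_Suc[of r] r P_row[OF r] inv_inv_eq[OF permutes_bij[OF f]] by (simp add: W_def)
qed

end

section \<open>Which covers of the weak order are contracted\<close>

section \<open>Covers of the weak order\<close>

lemma turning_cong:
  assumes "\<And>u. u \<in> {1..n} \<Longrightarrow> f u < f j \<longleftrightarrow> g u < g j" "r \<in> {1..n}"
  shows "turning n q f r j \<longleftrightarrow> turning n q g r j"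
proof -
  have "{u \<in> {1..n}. f u < f j \<and> q j < q u} = {u \<in> {1..n}. g u < g j \<and> q j < q u}"
    using assms(1) by blast
  moreover have "{u \<in> {1..<r}. f u < f j} = {u \<in> {1..<r}. g u < g j}"
    using assms by auto
  ultimately show ?thesis using assms by (simp add: turning_def)
qed

text \<open>Only rows \<open>r < j\<close> carry information: pipe \<open>j\<close> turns in row
  \<open>j\<close>, where it enters, and never reaches a lower row.\<close>

definition same_turning :: "nat \<Rightarrow> (nat \<Rightarrow> nat) \<Rightarrow> (nat \<Rightarrow> nat) \<Rightarrow> (nat \<Rightarrow> nat) \<Rightarrow> bool" where
  "same_turning n q f g \<longleftrightarrow>
    (\<forall>r j. 1 \<le> r \<longrightarrow> r < j \<longrightarrow> j \<le> n \<longrightarrow> turning n q f r j = turning n q g r j)"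

definition lower_left :: "(nat \<Rightarrow> nat) \<Rightarrow> nat \<Rightarrow> nat \<Rightarrow> nat set" where
  "lower_left q i j = {u \<in> {1..<i}. q u < q j}"

definition between_before :: "(nat \<Rightarrow> nat) \<Rightarrow> (nat \<Rightarrow> nat) \<Rightarrow> nat \<Rightarrow> nat \<Rightarrow> nat set" where
  "between_before q f i j = {u \<in> {i<..<j}. f u < f i \<and> q j < q u}"

lemma finite_lower_left [simp]: "finite (lower_left q i j)"
  by (simp add: lower_left_def)

lemma finite_between_before [simp]: "finite (between_before q f i j)"
  by (simp add: between_before_def)

lemma lower_left_mono: "i \<le> a \<Longrightarrow> q j \<le> q b \<Longrightarrow> card (lower_left q i j) \<le> card (lower_left q a b)"
  by (rule card_mono) (auto simp: lower_left_def)

locale weak_cover =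
  fixes n :: nat and q f f' :: "nat \<Rightarrow> nat" and a b :: nat
  assumes q: "q permutes {1..n}" and f: "f permutes {1..n}"
    and ab: "1 \<le> a" "a < b" "b \<le> n" and adj: "f b = Suc (f a)"
    and f'_def: "f' = adj_swap f a b"
    and bel: "below n q f" and bel': "below n q f'"
begin

lemma f'_less: "f' x < f' y \<longleftrightarrow> (if x = a \<and> y = b then False else if x = b \<and> y = a then True else f x < f y)"
  unfolding f'_def by (rule adj_swap_less_iff[where n = n]) (use f adj in auto)

lemma q_less: "q b < q a"
proof (rule ccontr)
  assume "\<not> q b < q a"
  then have "q a < q b" using permutes_ne[OF q, of a b] ab by simp
  then have "f' a < f' b" using bel' ab unfolding below_def by auto
  then show False using f'_less by simp
qed

lemma f_less_b: "f u < f b \<longleftrightarrow> f u < f a \<or> u = a"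
  using adj permutes_ne[OF f, of u a] by auto

text \<open>The two counts share the earlier \<open>u < a\<close> lying right of \<open>b\<close> in
  \<omega>. Since \<open>f\<close> is below \<omega>, no \<open>u > b\<close> contributes to the
  first count, and every member of \<open>lower_left\<close> does precede \<open>a\<close> and
  contributes to the second.\<close>

lemma card_before_split:
  "card {u \<in> {1..n}. f u < f a \<and> q b < q u} =
    card {u \<in> {1..<a}. f u < f a \<and> q b < q u} + card (between_before q f a b)"
  "card {u \<in> {1..<a}. f u < f a} =
    card {u \<in> {1..<a}. f u < f a \<and> q b < q u} + card (lower_left q a b)"
proof -
  have "u < b" if "u \<in> {1..n}" "f u < f a" "q b < q u" for u
  proof (rule ccontr)
    assume "\<not> u < b"
    moreover have "u \<noteq> b" using that by auto
    ultimately have "f b < f u" using bel that ab unfolding below_def by auto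
    then show False using that adj by simp
  qed
  then have "u \<in> {1..n} \<and> f u < f a \<and> q b < q u \<longleftrightarrow>
      u \<in> {1..<a} \<and> f u < f a \<and> q b < q u \<or> u \<in> between_before q f a b" for u
    using ab by (cases u a rule: linorder_cases) (auto simp: between_before_def)
  then have "{u \<in> {1..n}. f u < f a \<and> q b < q u} =
      {u \<in> {1..<a}. f u < f a \<and> q b < q u} \<union> between_before q f a b"
    by blast
  moreover have "{u \<in> {1..<a}. f u < f a \<and> q b < q u} \<inter> between_before q f a b = {}"
    by (auto simp: between_before_def)
  ultimately show "card {u \<in> {1..n}. f u < f a \<and> q b < q u} =
    card {u \<in> {1..<a}. f u < f a \<and> q b < q u} + card (between_before q f a b)"
    by (simp add: card_Un_disjoint)
  have "f u < f a" if "u \<in> {1..<a}" "q u < q b" for u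
  proof -
    have "f u < f b" using bel that ab unfolding below_def by auto
    then show ?thesis using f_less_b that by auto
  qed
  moreover have "q u < q b \<or> q b < q u" if "u \<in> {1..<a}" for u
    using permutes_ne[OF q, of u b] that ab by (auto simp: neq_iff)
  ultimately have "{u \<in> {1..<a}. f u < f a} =
      {u \<in> {1..<a}. f u < f a \<and> q b < q u} \<union> lower_left q a b"
    by (auto simp: lower_left_def)
  moreover have "{u \<in> {1..<a}. f u < f a \<and> q b < q u} \<inter> lower_left q a b = {}"
    by (auto simp: lower_left_def)
  ultimately show "card {u \<in> {1..<a}. f u < f a} =
    card {u \<in> {1..<a}. f u < f a \<and> q b < q u} + card (lower_left q a b)"
    by (simp add: card_Un_disjoint)
qed

abbreviation contracted where
  "contracted \<equiv> card (lower_left q a b) \<le> card (between_before q f a b)"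

lemma contracted_iff:
  "contracted \<longleftrightarrow> card {u \<in> {1..<a}. f u < f a} \<le> card {u \<in> {1..n}. f u < f a \<and> q b < q u}"
  using card_before_split by linarith

text \<open>As \<open>a\<close> lies right of \<open>b\<close> in \<omega>, it adds one to the
  left-hand count for \<open>f\<close>, but not for \<open>f'\<close>, where it is later than
  \<open>b\<close>. On the right-hand side it adds one for \<open>f\<close> in the rows after
  \<open>a\<close>.\<close>

lemma turning_at_b:
  assumes "r \<in> {1..<b}"
  shows "turning n q f r b \<longleftrightarrow> (f r < f a \<or> r = a) \<and>
      card {u \<in> {1..n}. f u < f a \<and> q b < q u} + 1 \<le>
      card {u \<in> {1..<r}. f u < f a} + (if a < r then 1 else 0)"
    and "turning n q f' r b \<longleftrightarrow> f r < f a \<and>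
      card {u \<in> {1..n}. f u < f a \<and> q b < q u} \<le> card {u \<in> {1..<r}. f u < f a}"
proof -
  have "{u \<in> {1..n}. f u < f b \<and> q b < q u} = insert a {u \<in> {1..n}. f u < f a \<and> q b < q u}"
  proof -
    have "u \<in> {1..n} \<and> f u < f b \<and> q b < q u \<longleftrightarrow> u = a \<or> u \<in> {1..n} \<and> f u < f a \<and> q b < q u" for u
      unfolding f_less_b using q_less ab by auto
    then show ?thesis by blast
  qed
  moreover have "{u \<in> {1..<r}. f u < f b} = (if a < r then insert a {u \<in> {1..<r}. f u < f a}
      else {u \<in> {1..<r}. f u < f a})"
    unfolding f_less_b using ab by auto
  ultimately show "turning n q f r b \<longleftrightarrow> (f r < f a \<or> r = a) \<and>
      card {u \<in> {1..n}. f u < f a \<and> q b < q u} + 1 \<le>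
      card {u \<in> {1..<r}. f u < f a} + (if a < r then 1 else 0)"
    using f_less_b by (simp add: turning_def)
  have less: "f' u < f' b \<longleftrightarrow> f u < f a" for u
    using f'_less[of u b] f_less_b[of u] by auto
  show "turning n q f' r b \<longleftrightarrow> f r < f a \<and>
      card {u \<in> {1..n}. f u < f a \<and> q b < q u} \<le> card {u \<in> {1..<r}. f u < f a}"
    unfolding turning_def less ..
qed

text \<open>For \<open>j = a\<close> only the comparison with \<open>b\<close> changes, but
  \<open>b\<close> lies left of \<open>a\<close> in \<omega> and is larger than every
  \<open>u < r\<close>, so no count sees it.\<close>

lemma turning_other:
  assumes "1 \<le> r" "r < j" "j \<le> n" "j \<noteq> b"
  shows "turning n q f r j \<longleftrightarrow> turning n q f' r j"
proof (cases "j = a")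
  case False
  then have "f u < f j \<longleftrightarrow> f' u < f' j" for u using f'_less[of u j] assms by auto
  then show ?thesis using turning_cong[of n f j f' r q] assms by auto
next
  case True
  have less: "f' u < f' a \<longleftrightarrow> f u < f a \<or> u = b" for u
    using f'_less[of u a] ab by auto
  have "{u \<in> {1..n}. f u < f a \<and> q a < q u} = {u \<in> {1..n}. (f u < f a \<or> u = b) \<and> q a < q u}"
    using q_less by auto
  moreover have "{u \<in> {1..<r}. f u < f a} = {u \<in> {1..<r}. f u < f a \<or> u = b}"
    using assms True ab by auto
  ultimately show ?thesis using True assms ab by (auto simp: turning_def less)
qed

text \<open>Row \<open>a\<close> is decisive: there pipe \<open>b\<close> turns for \<open>f\<close>
  exactly if the cover is not contracted, and never for \<open>f'\<close>. Under contraction the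
  right-hand count is too small for both in rows \<open>r < a\<close>, and in rows
  \<open>r > a\<close> the two contributions of \<open>a\<close> cancel.\<close>

lemma same_turning_iff: "same_turning n q f f' \<longleftrightarrow> contracted"
proof
  assume "same_turning n q f f'"
  then have "turning n q f a b = turning n q f' a b" using ab unfolding same_turning_def by blast
  then have "\<not> turning n q f a b" using turning_at_b(2)[of a] ab by auto
  then show contracted using turning_at_b(1)[of a] ab contracted_iff by auto
next
  assume contracted
  then have c: "card {u \<in> {1..<a}. f u < f a} \<le> card {u \<in> {1..n}. f u < f a \<and> q b < q u}"
    using contracted_iff by blast
  have "turning n q f r b \<longleftrightarrow> turning n q f' r b" if r: "r \<in> {1..<b}" for r
  proof (cases "f r < f a \<and> r < a")
    case True
    then have "{u \<in> {1..<r}. f u < f a} \<subset> {u \<in> {1..<a}. f u < f a}" using r by auto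
    then have "card {u \<in> {1..<r}. f u < f a} < card {u \<in> {1..<a}. f u < f a}"
      by (intro psubset_card_mono) auto
    then show ?thesis using turning_at_b[OF r] c True by auto
  next
    case False
    show ?thesis
    proof (cases "r = a")
      case True
      then show ?thesis using turning_at_b[OF r] c by auto
    qed (use turning_at_b[OF r] False in auto)
  qed
  then show "same_turning n q f f'"
    unfolding same_turning_def using turning_other by (metis atLeastLessThan_iff)
qed

end

section \<open>Principal filters and ideals detecting the covers that are not contracted\<close>

section \<open>Testing the congruence\<close>

text \<open>
  An up-test is preserved by going up and by meets, a down-test by going down and by joins. A
  cover is contracted iff all up-tests agree on it, iff all down-tests agree on it.
\<close>

definition up_index :: "nat \<Rightarrow> (nat \<Rightarrow> nat) \<Rightarrow> nat \<Rightarrow> nat \<Rightarrow> nat set \<Rightarrow> bool" where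
  "up_index n q i j D \<longleftrightarrow> 1 \<le> i \<and> i < j \<and> j \<le> n \<and> D \<subseteq> {i..j} \<and> i \<notin> D \<and> j \<in> D \<and>
    card {u \<in> D. u < j \<and> q j < q u} < card (lower_left q i j)"

definition up_test :: "(nat \<Rightarrow> nat) \<Rightarrow> nat \<Rightarrow> nat \<Rightarrow> nat set \<Rightarrow> bool" where
  "up_test f i j D \<longleftrightarrow> (\<forall>x\<in>{i..j} - D. \<forall>y\<in>D. x < y \<longrightarrow> f y < f x)"

text \<open>The condition on the complement makes \<open>q j \<le> q b\<close> hold whenever the
  cover leaves the test. Up-tests get by without a counterpart: for \<open>b\<close> in
  \<open>D\<close> left of \<open>j\<close> in \<omega>, \<open>b\<close> precedes \<open>j\<close>,
  whereas the test would place \<open>j\<close>, also in \<open>D\<close>, before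
  \<open>a\<close>.\<close>

definition down_index :: "nat \<Rightarrow> (nat \<Rightarrow> nat) \<Rightarrow> nat \<Rightarrow> nat \<Rightarrow> nat set \<Rightarrow> bool" where
  "down_index n q i j D \<longleftrightarrow> 1 \<le> i \<and> i < j \<and> j \<le> n \<and> D \<subseteq> {i..j} \<and> i \<in> D \<and> j \<notin> D \<and>
    (\<forall>y\<in>{i..j} - D. q j \<le> q y) \<and>
    card {u \<in> D. i < u \<and> q j < q u} < card (lower_left q i j)"

definition down_test :: "(nat \<Rightarrow> nat) \<Rightarrow> nat \<Rightarrow> nat \<Rightarrow> nat set \<Rightarrow> bool" where
  "down_test f i j D \<longleftrightarrow> (\<forall>x\<in>D. \<forall>y\<in>{i..j} - D. x < y \<longrightarrow> f x < f y)"

context weak_cover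
begin

text \<open>The cover can only matter if \<open>a\<close> is outside \<open>D\<close> and
  \<open>b\<close> inside. If \<open>q j \<le> q b\<close>, the test at \<open>f'\<close> forces
  \<open>between_before\<close> into \<open>D\<close>, and the bound in \<open>up_index\<close>
  together with \<open>lower_left_mono\<close> contradicts contraction.\<close>

lemma up_test_contracted:
  assumes contracted and D: "up_index n q i j D"
  shows "up_test f i j D \<longleftrightarrow> up_test f' i j D"
proof
  assume "up_test f i j D"
  then show "up_test f' i j D" using ab unfolding up_test_def f'_less by auto
next
  assume t: "up_test f' i j D"
  show "up_test f i j D"
  proof (rule ccontr)
    assume "\<not> up_test f i j D"
    then obtain x y where xy: "x \<in> {i..j} - D" "y \<in> D" "x < y" "\<not> f y < f x"
      unfolding up_test_def by blast
    moreover have "f' y < f' x" using t xy unfolding up_test_def by blast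
    ultimately have "x = a" "y = b" using f'_less[of y x] by (auto split: if_splits)
    note D' = D[unfolded up_index_def]
    have aD: "a \<in> {i..j} - D" "b \<in> D" using xy \<open>x = a\<close> \<open>y = b\<close> by auto
    show False
    proof (cases "q j \<le> q b")
      case True
      have "between_before q f a b \<subseteq> {u \<in> D. u < j \<and> q j < q u}"
      proof
        fix u assume "u \<in> between_before q f a b"
        then have u: "a < u" "u < b" "f u < f a" "q b < q u" by (auto simp: between_before_def)
        have "b \<le> j" using aD D' by auto
        have "u \<in> D"
        proof (rule ccontr)
          assume "u \<notin> D"
          then have "f' b < f' u" using t aD u \<open>b \<le> j\<close> unfolding up_test_def by auto
          then show False using f'_less[of b u] u adj by (auto split: if_splits)
        qed
        then show "u \<in> {u \<in> D. u < j \<and> q j < q u}" using u True \<open>b \<le> j\<close> by auto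
      qed
      then have "card (between_before q f a b) \<le> card {u \<in> D. u < j \<and> q j < q u}"
        by (intro card_mono) (use D' finite_subset[of D "{i..j}"] in simp_all)
      also have "\<dots> < card (lower_left q i j)" using D' by blast
      also have "\<dots> \<le> card (lower_left q a b)" using lower_left_mono True aD by auto
      finally show False using assms by simp
    next
      case False
      then have "b \<noteq> j" by auto
      then have bj: "b < j" using aD D' by force
      then have "f b < f j" using False bel ab D' unfolding below_def by auto
      moreover have "f' j < f' a" using t aD bj ab D' unfolding up_test_def by auto
      ultimately show False using f'_less[of j a] bj ab adj by auto
    qed
  qed
qed

lemma up_test_not_contracted:
  assumes "\<not> contracted"
  obtains D where "up_index n q a b D" "up_test f' a b D" "\<not> up_test f a b D"
proof -
  \<comment> \<open>Among the values between \<open>a\<close> and \<open>b\<close>, those standing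
    before both in the word; the count in \<open>up_index\<close> becomes exactly the one that fails
    contraction.\<close>
  define D where "D = insert b {u \<in> {a<..<b}. f u < f a}"
  have "{u \<in> D. u < b \<and> q b < q u} = between_before q f a b"
    by (auto simp: D_def between_before_def)
  then have "card {u \<in> D. u < b \<and> q b < q u} < card (lower_left q a b)" using assms by simp
  moreover have D: "D \<subseteq> {a..b}" "a \<notin> D" "b \<in> D" using ab by (auto simp: D_def)
  ultimately have "up_index n q a b D" using ab unfolding up_index_def by blast
  moreover have "\<not> up_test f a b D"
  proof
    assume "up_test f a b D"
    then have "f b < f a" using D ab unfolding up_test_def by auto
    then show False using adj by simp
  qed
  moreover have "up_test f' a b D"
    unfolding up_test_def
  proof (intro ballI impI)
    fix x y assume x: "x \<in> {a..b} - D" and y: "y \<in> D" and "x < y"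
    have "x \<noteq> b" using x by (auto simp: D_def)
    then have "x = a \<or> x \<in> {a<..<b}" using x by auto
    then have x': "f a \<le> f x" "x \<noteq> b" using x by (auto simp: D_def)
    then have "f b < f x \<or> x = a" using f_less_b[of x] permutes_ne[OF f, of x b] by auto
    moreover have "y = b \<or> f y < f a" using y by (auto simp: D_def)
    ultimately show "f' y < f' x" using f'_less[of y x] x' \<open>x < y\<close> by auto
  qed
  ultimately show ?thesis using that by blast
qed

lemma down_test_contracted:
  assumes contracted and D: "down_index n q i j D"
  shows "down_test f i j D \<longleftrightarrow> down_test f' i j D"
proof
  assume "down_test f' i j D"
  then show "down_test f i j D"
    using ab adj unfolding down_test_def f'_less by (metis lessI order_less_asym)
next
  assume t: "down_test f i j D"
  show "down_test f' i j D"
  proof (rule ccontr)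
    assume "\<not> down_test f' i j D"
    then obtain x y where xy: "x \<in> D" "y \<in> {i..j} - D" "x < y" "\<not> f' x < f' y"
      unfolding down_test_def by blast
    moreover have "f x < f y" using t xy unfolding down_test_def by blast
    ultimately have "x = a" "y = b" using f'_less[of x y] by (auto split: if_splits)
    note D' = D[unfolded down_index_def]
    have aD: "a \<in> D" "b \<in> {i..j} - D" using xy \<open>x = a\<close> \<open>y = b\<close> by auto
    then have qb: "q j \<le> q b" using D' by blast
    have "between_before q f a b \<subseteq> {u \<in> D. i < u \<and> q j < q u}"
    proof
      fix u assume "u \<in> between_before q f a b"
      then have u: "a < u" "u < b" "f u < f a" "q b < q u" by (auto simp: between_before_def)
      have "i \<le> a" using aD D' by auto
      have "u \<in> D"
      proof (rule ccontr)
        assume "u \<notin> D"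
        then have "f a < f u" using t aD u \<open>i \<le> a\<close> unfolding down_test_def by auto
        then show False using u by simp
      qed
      then show "u \<in> {u \<in> D. i < u \<and> q j < q u}" using u qb \<open>i \<le> a\<close> by auto
    qed
    then have "card (between_before q f a b) \<le> card {u \<in> D. i < u \<and> q j < q u}"
      by (intro card_mono) (use D' finite_subset[of D "{i..j}"] in simp_all)
    also have "\<dots> < card (lower_left q i j)" using D' by blast
    also have "\<dots> \<le> card (lower_left q a b)" using lower_left_mono qb aD D' by auto
    finally show False using assms by simp
  qed
qed

lemma down_test_not_contracted:
  assumes "\<not> contracted"
  obtains D where "down_index n q a b D" "down_test f a b D" "\<not> down_test f' a b D"
proof -
  \<comment> \<open>Values left of \<open>b\<close> in \<omega> are added so that the complement
    satisfies \<open>down_index\<close>. They do not enter the count, and \<open>below\<close> puts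
    them before every larger value of the complement.\<close>
  define D where "D = {u \<in> {a..b}. f u \<le> f a \<or> q u < q b}"
  have "{u \<in> D. a < u \<and> q b < q u} = between_before q f a b"
  proof -
    have "u \<in> D \<and> a < u \<and> q b < q u \<longleftrightarrow> u \<in> between_before q f a b" for u
    proof
      assume u: "u \<in> D \<and> a < u \<and> q b < q u"
      then have "f u \<le> f a" "u \<le> b" by (auto simp: D_def)
      moreover have "f u \<noteq> f a" "u \<noteq> b" using permutes_ne[OF f, of u a] u by auto
      ultimately show "u \<in> between_before q f a b" using u by (simp add: between_before_def)
    qed (simp add: D_def between_before_def)
    then show ?thesis by blast
  qed
  then have "card {u \<in> D. a < u \<and> q b < q u} < card (lower_left q a b)" using assms by simp
  moreover have D: "D \<subseteq> {a..b}" "a \<in> D" "b \<notin> D" "\<forall>y\<in>{a..b} - D. q b \<le> q y"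
    using ab adj by (auto simp: D_def)
  ultimately have "down_index n q a b D" using ab unfolding down_index_def by blast
  moreover have "\<not> down_test f' a b D"
  proof
    assume "down_test f' a b D"
    then have "f' a < f' b" using D ab unfolding down_test_def by auto
    then show False using f'_less by simp
  qed
  moreover have "down_test f a b D"
    unfolding down_test_def
  proof (intro ballI impI)
    fix x y assume x: "x \<in> D" and y: "y \<in> {a..b} - D" and "x < y"
    have y': "f a < f y" "q b \<le> q y" using y by (auto simp: D_def)
    show "f x < f y"
    proof (cases "f x \<le> f a")
      case False
      then have "q x < q y" using x y' by (auto simp: D_def)
      then show ?thesis using bel x y \<open>x < y\<close> ab unfolding below_def D_def by auto
    qed (use y' in simp)
  qed
  ultimately show ?thesis using that by blast
qed

end

lemma up_test_mono:
  assumes "Inv n f \<subseteq> Inv n g" "up_index n q i j D" "up_test f i j D"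
  shows "up_test g i j D"
  unfolding up_test_def
proof (intro ballI impI)
  fix x y assume x: "x \<in> {i..j} - D" "y \<in> D" "x < y"
  then have "(x, y) \<in> Inv n f" using assms(2,3) by (auto simp: up_index_def up_test_def Inv_def)
  then show "g y < g x" using assms(1) by (auto simp: Inv_def)
qed

text \<open>A non-inversion of the meet is a chain of non-inversions of \<open>f\<close> and
  \<open>g\<close>. Within the segment no such step leads from the complement into \<open>D\<close>,
  so neither does the chain.\<close>

lemma up_test_meet:
  assumes h: "h permutes {1..n}" and N: "NonInv n h = (NonInv n f \<union> NonInv n g)\<^sup>+"
    and D: "up_index n q i j D" and t: "up_test f i j D" "up_test g i j D"
  shows "up_test h i j D"
proof (rule ccontr)
  assume "\<not> up_test h i j D"
  then obtain x y where xy: "x \<in> {i..j} - D" "y \<in> D" "x < y" "\<not> h y < h x"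
    unfolding up_test_def by blast
  have D': "1 \<le> i" "j \<le> n" "D \<subseteq> {i..j}" using D by (auto simp: up_index_def)
  have "h x < h y" using xy permutes_ne[OF h, of x y] by simp
  then have "(x, y) \<in> (NonInv n f \<union> NonInv n g)\<^sup>+"
    using xy D' unfolding N[symmetric] by (auto simp: NonInv_def)
  moreover have no: "z' \<notin> D \<and> x < z'"
    if "(z, z') \<in> NonInv n f \<union> NonInv n g" "z' \<le> j" "z \<notin> D" "x \<le> z" for z z'
  proof -
    have "z < z'" "f z < f z' \<or> g z < g z'" "z \<in> {i..j} - D"
      using that xy by (auto simp: NonInv_def)
    then show ?thesis using t that(4) unfolding up_test_def by (metis less_asym order_le_less_trans)
  qed
  ultimately have "y \<le> j \<longrightarrow> y \<notin> D \<and> x < y"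
  proof (induction rule: trancl_induct)
    case (base z)
    then show ?case using no[of x z] xy by auto
  next
    case (step z z')
    moreover have "z < z'" using step(2) by (auto simp: NonInv_def)
    ultimately show ?case using no[OF step(2)] step(3) by (meson less_imp_le less_le_trans)
  qed
  then show False using xy D' by auto
qed

lemma down_test_antimono:
  assumes "NonInv n f \<subseteq> NonInv n g" "down_index n q i j D" "down_test f i j D"
  shows "down_test g i j D"
  unfolding down_test_def
proof (intro ballI impI)
  fix x y assume x: "x \<in> D" "y \<in> {i..j} - D" "x < y"
  then have "(x, y) \<in> NonInv n f"
    using assms(2,3) by (auto simp: down_index_def down_test_def NonInv_def)
  then show "g x < g y" using assms(1) by (auto simp: NonInv_def)
qed

lemma down_test_join:
  assumes h: "h permutes {1..n}" and N: "Inv n h = (Inv n f \<union> Inv n g)\<^sup>+"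
    and D: "down_index n q i j D" and t: "down_test f i j D" "down_test g i j D"
  shows "down_test h i j D"
proof (rule ccontr)
  assume "\<not> down_test h i j D"
  then obtain x y where xy: "x \<in> D" "y \<in> {i..j} - D" "x < y" "\<not> h x < h y"
    unfolding down_test_def by blast
  have D': "1 \<le> i" "j \<le> n" "D \<subseteq> {i..j}" using D by (auto simp: down_index_def)
  have "h y < h x" using xy permutes_ne[OF h, of x y] by simp
  then have "(x, y) \<in> (Inv n f \<union> Inv n g)\<^sup>+"
    using xy D' unfolding N[symmetric] by (auto simp: Inv_def)
  moreover have no: "z' \<in> D \<and> x < z'"
    if "(z, z') \<in> Inv n f \<union> Inv n g" "z' \<le> j" "z \<in> D" "x \<le> z" for z z'
  proof -
    have "z < z'" "f z' < f z \<or> g z' < g z" "z' \<in> {i..j}"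
      using that xy D' by (auto simp: Inv_def)
    then show ?thesis using t that(3,4) unfolding down_test_def
      by (metis DiffI less_asym order_le_less_trans)
  qed
  ultimately have "y \<le> j \<longrightarrow> y \<in> D \<and> x < y"
  proof (induction rule: trancl_induct)
    case (base z)
    then show ?case using no[of x z] xy by auto
  next
    case (step z z')
    moreover have "z < z'" using step(2) by (auto simp: Inv_def)
    ultimately show ?case using no[OF step(2)] step(3) by (meson less_imp_le less_le_trans)
  qed
  then show False using xy D' by auto
qed

section \<open>Equal turning, equal up-tests and equal down-tests describe the same classes\<close>

section \<open>The classes of the congruence\<close>

definition same_up :: "nat \<Rightarrow> (nat \<Rightarrow> nat) \<Rightarrow> (nat \<Rightarrow> nat) \<Rightarrow> (nat \<Rightarrow> nat) \<Rightarrow> bool" where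
  "same_up n q f g \<longleftrightarrow> (\<forall>i j D. up_index n q i j D \<longrightarrow> up_test f i j D = up_test g i j D)"

definition same_down :: "nat \<Rightarrow> (nat \<Rightarrow> nat) \<Rightarrow> (nat \<Rightarrow> nat) \<Rightarrow> (nat \<Rightarrow> nat) \<Rightarrow> bool" where
  "same_down n q f g \<longleftrightarrow> (\<forall>i j D. down_index n q i j D \<longrightarrow> down_test f i j D = down_test g i j D)"

lemma below_iff_NonInv: "below n q f \<longleftrightarrow> NonInv n q \<subseteq> NonInv n f"
  by (auto simp: below_def NonInv_def subset_iff)

lemma below_iff_Inv:
  assumes "q permutes {1..n}" "f permutes {1..n}"
  shows "below n q f \<longleftrightarrow> Inv n f \<subseteq> Inv n q"
  using below_iff_NonInv Inv_subset_iff_NonInv[OF assms(2,1)] by blast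

text \<open>As \<open>f\<close> is below \<open>g\<close>, every neighbouring disagreement is an
  ascent of \<open>h\<close>, so each swap is a cover going up.\<close>

lemma weak_order_path:
  assumes f: "f permutes {1..n}" and g: "g permutes {1..n}" and le: "Inv n f \<subseteq> Inv n g"
    and start: "\<Phi> f"
    and step: "\<And>h a b. h permutes {1..n} \<Longrightarrow> 1 \<le> a \<Longrightarrow> a < b \<Longrightarrow> b \<le> n \<Longrightarrow> h b = Suc (h a) \<Longrightarrow>
      Inv n f \<subseteq> Inv n h \<Longrightarrow> Inv n h \<subseteq> Inv n (adj_swap h a b) \<Longrightarrow> Inv n (adj_swap h a b) \<subseteq> Inv n g \<Longrightarrow>
      \<Phi> h \<Longrightarrow> \<Phi> (adj_swap h a b)"
  shows "\<Phi> g"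
proof (rule adjacent_swap_path[OF f g, of \<Phi>])
  have le': "NonInv n g \<subseteq> NonInv n f" using le Inv_subset_iff_NonInv f g by blast
  fix h a b
  assume h: "h permutes {1..n}"
    and btw: "\<And>i j. i \<in> {1..n} \<Longrightarrow> j \<in> {1..n} \<Longrightarrow> f i < f j \<Longrightarrow> g i < g j \<Longrightarrow> h i < h j"
    and a: "a \<in> {1..n}" and b: "b \<in> {1..n}" and adj: "h b = Suc (h a)" and gba: "g b < g a"
    and \<Phi>: "\<Phi> h"
  have non: "h i < h j" if "(i, j) \<in> NonInv n g" for i j
    using btw[of i j] that le' by (auto simp: NonInv_def)
  have "a < b"
  proof (rule ccontr)
    assume "\<not> a < b"
    then have "(b, a) \<in> NonInv n g" using gba a b by (auto simp: NonInv_def) (metis nat_neq_iff)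
    then show False using non adj by fastforce
  qed
  note less = adj_swap_less_iff[OF h adj]
  have "Inv n f \<subseteq> Inv n h"
  proof (rule subrelI)
    fix i j assume "(i, j) \<in> Inv n f"
    moreover from this have "(i, j) \<in> Inv n g" using le by blast
    ultimately show "(i, j) \<in> Inv n h" using btw[of j i] by (auto simp: Inv_def)
  qed
  moreover have "Inv n h \<subseteq> Inv n (adj_swap h a b)"
    using \<open>a < b\<close> by (auto simp: Inv_def less)
  moreover have "Inv n (adj_swap h a b) \<subseteq> Inv n g"
  proof (rule subrelI)
    fix i j assume ij: "(i, j) \<in> Inv n (adj_swap h a b)"
    show "(i, j) \<in> Inv n g"
    proof (rule ccontr)
      assume "(i, j) \<notin> Inv n g"
      then have "(i, j) \<in> NonInv n g" using ij NonInv_iff[OF g, of i j] by (auto simp: Inv_def)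
      then have "h i < h j" "g i < g j" using non by (auto simp: NonInv_def)
      then show False using ij gba by (auto simp: Inv_def less split: if_splits)
    qed
  qed
  ultimately show "\<Phi> (adj_swap h a b)"
    using step[of h a b] h a b adj \<open>a < b\<close> \<Phi> by auto
qed (rule start)

lemma same_turning_refl: "same_turning n q f f"
  by (simp add: same_turning_def)

lemma same_turning_sym: "same_turning n q f g \<Longrightarrow> same_turning n q g f"
  by (simp add: same_turning_def)

lemma same_turning_trans: "same_turning n q f g \<Longrightarrow> same_turning n q g h \<Longrightarrow> same_turning n q f h"
  by (simp add: same_turning_def)

text \<open>Every cover on a chain from \<open>f\<close> to \<open>g\<close> is contracted: a test
  separating its ends would, by monotonicity, fail at \<open>f\<close> and hold at
  \<open>g\<close>.\<close>

lemma same_up_le_imp_same_turning: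
  assumes q: "q permutes {1..n}" and f: "f permutes {1..n}" and g: "g permutes {1..n}"
    and le: "Inv n f \<subseteq> Inv n g" "Inv n g \<subseteq> Inv n q" and same: "same_up n q f g"
  shows "same_turning n q f g"
proof (rule weak_order_path[OF f g le(1)])
  fix h a b assume h: "h permutes {1..n}" and ab: "1 \<le> a" "a < b" "b \<le> n" "h b = Suc (h a)"
    and le': "Inv n f \<subseteq> Inv n h" "Inv n h \<subseteq> Inv n (adj_swap h a b)" "Inv n (adj_swap h a b) \<subseteq> Inv n g"
    and st: "same_turning n q f h"
  have h': "adj_swap h a b permutes {1..n}" using adj_swap_permutes[OF h] ab by auto
  interpret weak_cover n q h "adj_swap h a b" a b
    using q h h' ab le le' below_iff_Inv by unfold_locales auto
  have contracted
  proof (rule ccontr)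
    assume "\<not> contracted"
    then obtain D where D: "up_index n q a b D" "up_test (adj_swap h a b) a b D" "\<not> up_test h a b D"
      by (rule up_test_not_contracted)
    then have "up_test g a b D" using up_test_mono le' by blast
    then have "up_test f a b D" using same D unfolding same_up_def by blast
    then show False using up_test_mono le' D by blast
  qed
  then show "same_turning n q f (adj_swap h a b)"
    using same_turning_iff st same_turning_trans by blast
qed (rule same_turning_refl)

lemma same_down_le_imp_same_turning:
  assumes q: "q permutes {1..n}" and f: "f permutes {1..n}" and g: "g permutes {1..n}"
    and le: "Inv n f \<subseteq> Inv n g" "Inv n g \<subseteq> Inv n q" and same: "same_down n q f g"
  shows "same_turning n q f g"
proof (rule weak_order_path[OF f g le(1)])
  fix h a b assume h: "h permutes {1..n}" and ab: "1 \<le> a" "a < b" "b \<le> n" "h b = Suc (h a)"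
    and le': "Inv n f \<subseteq> Inv n h" "Inv n h \<subseteq> Inv n (adj_swap h a b)" "Inv n (adj_swap h a b) \<subseteq> Inv n g"
    and st: "same_turning n q f h"
  have h': "adj_swap h a b permutes {1..n}" using adj_swap_permutes[OF h] ab by auto
  note non = le'(1)[unfolded Inv_subset_iff_NonInv[OF f h]] le'(3)[unfolded Inv_subset_iff_NonInv[OF h' g]]
  interpret weak_cover n q h "adj_swap h a b" a b
    using q h h' ab le le' below_iff_Inv by unfold_locales auto
  have contracted
  proof (rule ccontr)
    assume "\<not> contracted"
    then obtain D where D: "down_index n q a b D" "down_test h a b D" "\<not> down_test (adj_swap h a b) a b D"
      by (rule down_test_not_contracted)
    then have "down_test f a b D" using down_test_antimono non by blast
    then have "down_test g a b D" using same D unfolding same_down_def by blast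
    then show False using down_test_antimono non D by blast
  qed
  then show "same_turning n q f (adj_swap h a b)"
    using same_turning_iff st same_turning_trans by blast
qed (rule same_turning_refl)

text \<open>The meet passes exactly the up-tests that \<open>f\<close> and \<open>g\<close> both
  pass, hence those of either one, and it is comparable to both.\<close>

lemma same_up_imp_same_turning:
  assumes q: "q permutes {1..n}" and f: "f permutes {1..n}" and g: "g permutes {1..n}"
    and le: "Inv n f \<subseteq> Inv n q" "Inv n g \<subseteq> Inv n q" and same: "same_up n q f g"
  shows "same_turning n q f g"
proof -
  obtain h where h: "h permutes {1..n}" "NonInv n h = (NonInv n f \<union> NonInv n g)\<^sup>+"
    by (rule weak_meet_exists)
  then have "NonInv n f \<subseteq> NonInv n h" "NonInv n g \<subseteq> NonInv n h" by auto
  then have hle: "Inv n h \<subseteq> Inv n f" "Inv n h \<subseteq> Inv n g"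
    using Inv_subset_iff_NonInv[OF h(1) f] Inv_subset_iff_NonInv[OF h(1) g] by auto
  have "same_up n q h f" "same_up n q h g"
    using same up_test_meet[OF h] up_test_mono[OF hle(1)] up_test_mono[OF hle(2)]
    unfolding same_up_def by blast+
  then have "same_turning n q h f" "same_turning n q h g"
    using same_up_le_imp_same_turning[OF q h(1)] f g hle le by blast+
  then show ?thesis using same_turning_sym same_turning_trans by blast
qed

lemma same_down_imp_same_turning:
  assumes q: "q permutes {1..n}" and f: "f permutes {1..n}" and g: "g permutes {1..n}"
    and le: "Inv n f \<subseteq> Inv n q" "Inv n g \<subseteq> Inv n q" and same: "same_down n q f g"
  shows "same_turning n q f g"
proof -
  obtain h where h: "h permutes {1..n}" "Inv n h = (Inv n f \<union> Inv n g)\<^sup>+"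
    by (rule weak_join_exists)
  have hq: "Inv n h \<subseteq> Inv n q"
    unfolding h(2) by (rule trancl_subset_trans) (use le Inv_trans in blast)+
  have hle: "Inv n f \<subseteq> Inv n h" "Inv n g \<subseteq> Inv n h" using h by auto
  then have non: "NonInv n h \<subseteq> NonInv n f" "NonInv n h \<subseteq> NonInv n g"
    using Inv_subset_iff_NonInv[OF f h(1)] Inv_subset_iff_NonInv[OF g h(1)] by auto
  have "same_down n q f h" "same_down n q g h"
    using same down_test_join[OF h] down_test_antimono[OF non(1)] down_test_antimono[OF non(2)]
    unfolding same_down_def by blast+
  then have "same_turning n q f h" "same_turning n q g h"
    using same_down_le_imp_same_turning[OF q _ h(1)] f g hle hq by blast+
  then show ?thesis using same_turning_sym same_turning_trans by blast
qed

lemma PD_rows: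
  assumes \<omega>: "\<omega> permutes {1..n}" and P: "P \<in> PD n \<omega>"
  obtains T W where "pipe_rows n P T W" "\<And>c. c \<in> {1..n} \<Longrightarrow> T 1 c = \<omega> c"
proof -
  have sub: "P \<subseteq> inner_cells n" using P by (simp add: PD_def pipe_dream_def)
  obtain T W where rows: "pipe_rows n P T W" using pipe_rows_exist[OF sub] .
  interpret pipe_rows n P T W by (rule rows)
  have "T 1 c = \<omega> c" if "c \<in> {1..n}" for c
  proof -
    have "\<omega> c \<in> {1..n}" using permutes_in_image[OF \<omega>] that by blast
    then have "exits_at P (\<omega> c) (inv \<omega> (\<omega> c))" using P unfolding PD_def by blast
    then show ?thesis
      using exits_at_iff[OF \<open>\<omega> c \<in> {1..n}\<close>] permutes_inverses(2)[OF \<omega>] by auto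
  qed
  then show ?thesis using rows that by blast
qed

lemma linear_extension_below:
  assumes \<omega>: "\<omega> permutes {1..n}" and P: "P \<in> PD n \<omega>" and ext: "\<pi> \<in> linear_extensions n P"
  shows "below n (inv \<omega>) (inv \<pi>)"
  unfolding below_def
proof (intro ballI impI)
  fix i j assume ij: "i \<in> {1..n}" "j \<in> {1..n}" "i < j" "inv \<omega> i < inv \<omega> j"
  obtain T W where rows: "pipe_rows n P T W" and T1: "\<And>c. c \<in> {1..n} \<Longrightarrow> T 1 c = \<omega> c"
    using PD_rows[OF \<omega> P] by blast
  interpret pipe_rows n P T W by (rule rows)
  have dream: "pipe_dream n P" using P by (simp add: PD_def)
  have im: "inv \<omega> i \<in> {1..n}" "inv \<omega> j \<in> {1..n}"
    using permutes_in_image[OF permutes_inv[OF \<omega>]] ij by blast+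
  then have "T 1 (inv \<omega> i) = i" "T 1 (inv \<omega> j) = j"
    using T1 permutes_inverses(1)[OF \<omega>] by simp_all
  moreover have "inv \<pi> (T 1 c) < inv \<pi> (T 1 d)" if "1 \<le> c" "c < d" "d \<le> n" "T 1 c < T 1 d" for c d
    using rows_reduced[OF dream ext, of 1] that by simp
  ultimately show "inv \<pi> i < inv \<pi> j" using im ij by (metis atLeastAtMost_iff)
qed

lemma linear_extension_turning:
  assumes \<omega>: "\<omega> permutes {1..n}" and P: "P \<in> PD n \<omega>" and ext: "\<pi> \<in> linear_extensions n P"
    and rows: "pipe_rows n P T W" and T1: "\<And>c. c \<in> {1..n} \<Longrightarrow> T 1 c = \<omega> c"
    and rc: "r \<in> {1..n}" "c \<in> {1..Suc n - r}" "T r c \<noteq> r"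
  shows "(r, c) \<notin> P \<longleftrightarrow> turning n (inv \<omega>) (inv \<pi>) r (T r c)"
proof -
  interpret pipe_rows n P T W by (rule rows)
  have dream: "pipe_dream n P" using P by (simp add: PD_def)
  have "inv \<omega> (T 1 c) = c" if "c \<in> {1..n}" for c
    using T1[OF that] permutes_inverses(2)[OF \<omega>] by simp
  then show ?thesis using turn_iff_turning[OF rows_ordered[OF dream ext] _ rc] by blast
qed

text \<open>The turning formula decides a cell from \<omega>, the linear extension and the pipe
  leaving it north. Conversely the top word and these decisions fix all crossings by
  \<open>pipe_rows_unique\<close>.\<close>

lemma same_pipe_dream_iff:
  assumes \<omega>: "\<omega> permutes {1..n}" and P: "P \<in> PD n \<omega>" and Q: "Q \<in> PD n \<omega>"
    and \<pi>: "\<pi> \<in> linear_extensions n P" and \<sigma>: "\<sigma> \<in> linear_extensions n Q"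
  shows "P = Q \<longleftrightarrow> same_turning n (inv \<omega>) (inv \<pi>) (inv \<sigma>)"
proof
  assume eq: "P = Q"
  obtain T W where rows: "pipe_rows n P T W" and T1: "\<And>c. c \<in> {1..n} \<Longrightarrow> T 1 c = \<omega> c"
    using PD_rows[OF \<omega> P] by blast
  show "same_turning n (inv \<omega>) (inv \<pi>) (inv \<sigma>)"
    unfolding same_turning_def
  proof (intro allI impI)
    fix r j assume rj: "1 \<le> r" "r < j" "j \<le> n"
    then obtain c where c: "c \<in> {1..Suc n - r}" "T r c = j"
      using pipe_rows.T_surj[OF rows, of r j] by auto
    then show "turning n (inv \<omega>) (inv \<pi>) r j = turning n (inv \<omega>) (inv \<sigma>) r j"
      using linear_extension_turning[OF \<omega> P \<pi> rows T1, of r c]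
        linear_extension_turning[OF \<omega> P _ rows T1, of \<sigma> r c] \<sigma> eq rj by auto
  qed
next
  assume same: "same_turning n (inv \<omega>) (inv \<pi>) (inv \<sigma>)"
  obtain T W where rows: "pipe_rows n P T W" and T1: "\<And>c. c \<in> {1..n} \<Longrightarrow> T 1 c = \<omega> c"
    using PD_rows[OF \<omega> P] by blast
  obtain T' W' where rows': "pipe_rows n Q T' W'" and T1': "\<And>c. c \<in> {1..n} \<Longrightarrow> T' 1 c = \<omega> c"
    using PD_rows[OF \<omega> Q] by blast
  show "P = Q"
  proof (rule pipe_rows_unique[OF rows rows'])
    fix r c assume rc: "r \<in> {1..n}" "c \<in> {1..n - r}" "T r c \<noteq> r"
    have c: "c \<in> {1..Suc n - r}" using rc by auto
    show "(r, c) \<in> P \<longleftrightarrow> \<not> turning n (inv \<omega>) (inv \<pi>) r (T r c)"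
      using linear_extension_turning[OF \<omega> P \<pi> rows T1 rc(1) c rc(3)] by auto
  next
    fix r c assume rc: "r \<in> {1..n}" "c \<in> {1..n - r}" "T' r c \<noteq> r"
    have c: "c \<in> {1..Suc n - r}" using rc by auto
    have "T' r c \<in> {r..n}" using pipe_rows.T_range[OF rows' rc(1) c] .
    then have "turning n (inv \<omega>) (inv \<pi>) r (T' r c) = turning n (inv \<omega>) (inv \<sigma>) r (T' r c)"
      using same rc unfolding same_turning_def by auto
    then show "(r, c) \<in> Q \<longleftrightarrow> \<not> turning n (inv \<omega>) (inv \<pi>) r (T' r c)"
      using linear_extension_turning[OF \<omega> Q \<sigma> rows' T1' rc(1) c rc(3)] by auto
  qed (use T1 T1' in simp)
qed

lemma inv_permutes:
  assumes "\<pi> permutes {1..n::nat}"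
  shows "inv \<pi> permutes {1..n}" "inv (inv \<pi>) = \<pi>"
  using assms by (simp_all add: permutes_inv permutes_inv_inv)

lemma contact_graph_ends [simp]:
  "tail (contact_graph n P) (i, p, j) = i" "head (contact_graph n P) (i, p, j) = j"
  by (simp_all add: contact_graph_def)

lemma arc_less:
  assumes "\<pi> \<in> linear_extensions n P" "(i, p, j) \<in> arcs (contact_graph n P)"
  shows "inv \<pi> i < inv \<pi> j"
proof -
  have "inv \<pi> (tail (contact_graph n P) (i, p, j)) < inv \<pi> (head (contact_graph n P) (i, p, j))"
    using assms unfolding linear_extensions_def by blast
  then show ?thesis by simp
qed

lemma inv_linear_extension_iff:
  assumes "h permutes {1..n}"
  shows "inv h \<in> linear_extensions n P \<longleftrightarrow>
    (\<forall>i p j. (i, p, j) \<in> arcs (contact_graph n P) \<longrightarrow> h i < h j)"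
proof -
  have "inv h \<in> linear_extensions n P \<longleftrightarrow>
      (\<forall>a \<in> arcs (contact_graph n P). h (tail (contact_graph n P) a) < h (head (contact_graph n P) a))"
    unfolding linear_extensions_def using inv_permutes[OF assms] by simp
  also have "\<dots> \<longleftrightarrow> (\<forall>i p j. (i, p, j) \<in> arcs (contact_graph n P) \<longrightarrow> h i < h j)"
    unfolding Ball_def split_paired_All contact_graph_ends by blast
  finally show ?thesis .
qed

text \<open>A swap is made only where \<sigma> disagrees, hence never along an arc, so the path
  stays among the linear extensions of \<open>P\<close>. Each swap keeps the turning and is
  therefore a contracted cover. The path need not be monotone; the two cases are covers going up and
  going down.\<close>

lemma linear_extensions_same_tests:
  assumes \<omega>: "\<omega> permutes {1..n}" and P: "P \<in> PD n \<omega>"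
    and \<pi>: "\<pi> \<in> linear_extensions n P" and \<sigma>: "\<sigma> \<in> linear_extensions n P"
  shows "same_up n (inv \<omega>) (inv \<pi>) (inv \<sigma>) \<and> same_down n (inv \<omega>) (inv \<pi>) (inv \<sigma>)"
proof -
  have p: "\<pi> permutes {1..n}" "\<sigma> permutes {1..n}" using \<pi> \<sigma> by (auto simp: linear_extensions_def)
  note f = inv_permutes[OF p(1)] and g = inv_permutes[OF p(2)] and q = inv_permutes[OF \<omega>]
  define \<Phi> where "\<Phi> h \<longleftrightarrow> inv h \<in> linear_extensions n P \<and>
    same_up n (inv \<omega>) (inv \<pi>) h \<and> same_down n (inv \<omega>) (inv \<pi>) h" for h
  have "\<Phi> (inv \<sigma>)"
  proof (rule adjacent_swap_path[OF f(1) g(1)])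
    show "\<Phi> (inv \<pi>)" using \<pi> f by (simp add: \<Phi>_def same_up_def same_down_def)
  next
    fix h a b
    assume h: "h permutes {1..n}"
      and btw: "\<And>i j. i \<in> {1..n} \<Longrightarrow> j \<in> {1..n} \<Longrightarrow> inv \<pi> i < inv \<pi> j \<Longrightarrow> inv \<sigma> i < inv \<sigma> j \<Longrightarrow> h i < h j"
      and ab: "a \<in> {1..n}" "b \<in> {1..n}" and adj: "h b = Suc (h a)" and gba: "inv \<sigma> b < inv \<sigma> a"
      and \<Phi>: "\<Phi> h"
    define h' where "h' = adj_swap h a b"
    have h': "h' permutes {1..n}" unfolding h'_def using adj_swap_permutes[OF h ab] .
    have ext: "inv h \<in> linear_extensions n P" using \<Phi> by (simp add: \<Phi>_def)
    have "h' i < h' j" if "(i, p, j) \<in> arcs (contact_graph n P)" for i p j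
      using arc_less[OF \<sigma> that] arc_less[OF ext that] gba inv_permutes(2)[OF h]
      by (auto simp: h'_def adj_swap_less_iff[OF h adj])
    then have ext': "inv h' \<in> linear_extensions n P"
      unfolding inv_linear_extension_iff[OF h'] by blast
    have same: "same_turning n (inv \<omega>) h h'"
      using same_pipe_dream_iff[OF \<omega> P P ext ext'] inv_permutes[OF h] inv_permutes[OF h'] by simp
    have bel: "below n (inv \<omega>) h" "below n (inv \<omega>) h'"
      using linear_extension_below[OF \<omega> P ext] linear_extension_below[OF \<omega> P ext']
        inv_permutes[OF h] inv_permutes[OF h'] by simp_all
    have "same_up n (inv \<omega>) h h' \<and> same_down n (inv \<omega>) h h'"
    proof (cases "a < b")
      case True
      interpret weak_cover n "inv \<omega>" h h' a b
        by (rule weak_cover.intro[OF q(1) h _ True _ adj h'_def bel]) (use ab in simp_all)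
      have contracted using same same_turning_iff by blast
      then show ?thesis
        using up_test_contracted down_test_contracted by (simp add: same_up_def same_down_def)
    next
      case False
      then have "b < a" using adj by (metis nat_neq_iff n_not_Suc_n)
      have "h = adj_swap h' b a"
        by (simp add: h'_def adj_swap_def fun_eq_iff transpose_commute[of b a])
      moreover have "h' a = Suc (h' b)" using adj by (simp add: h'_def adj_swap_def)
      ultimately interpret weak_cover n "inv \<omega>" h' h b a
        by unfold_locales (use q(1) h' ab \<open>b < a\<close> bel in simp_all)
      have contracted using same_turning_sym[OF same] same_turning_iff by blast
      then show ?thesis
        using up_test_contracted down_test_contracted by (simp add: same_up_def same_down_def)
    qed
    then show "\<Phi> (adj_swap h a b)"
      using \<Phi> ext' unfolding \<Phi>_def h'_def[symmetric] by (simp add: same_up_def same_down_def)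
  qed
  then show ?thesis by (simp add: \<Phi>_def)
qed

section \<open>The interval as a lattice whose operations respect the classes\<close>

section \<open>The interval and its congruence\<close>

lemma carrier_weak_interval:
  "carrier (weak_interval n \<omega>) = {\<pi>. \<pi> permutes {1..n} \<and> Inv n (inv \<pi>) \<subseteq> Inv n (inv \<omega>)}"
  by (auto simp: weak_interval_def weak_le_def inversions_eq_Inv Inv_def inv_id)

lemma le_weak_interval: "\<pi> \<sqsubseteq>\<^bsub>weak_interval n \<omega>\<^esub> \<sigma> \<longleftrightarrow> Inv n (inv \<pi>) \<subseteq> Inv n (inv \<sigma>)"
  by (simp add: weak_interval_def weak_le_def inversions_eq_Inv)

lemma partial_order_weak_interval: "partial_order (weak_interval n \<omega>)"
proof
  fix x y assume xy: "x \<in> carrier (weak_interval n \<omega>)" "y \<in> carrier (weak_interval n \<omega>)"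
    and "x \<sqsubseteq>\<^bsub>weak_interval n \<omega>\<^esub> y" "y \<sqsubseteq>\<^bsub>weak_interval n \<omega>\<^esub> x"
  then have "Inv n (inv x) = Inv n (inv y)" unfolding le_weak_interval by blast
  moreover have p: "x permutes {1..n}" "y permutes {1..n}"
    using xy by (simp_all add: carrier_weak_interval)
  ultimately have "inv x = inv y"
    using Inv_eq_imp_eq inv_permutes(1) by blast
  then have "x = y" using inv_permutes(2)[OF p(1)] inv_permutes(2)[OF p(2)] by metis
  then show "x .=\<^bsub>weak_interval n \<omega>\<^esub> y" by (simp add: weak_interval_def)
qed (auto simp: weak_interval_def weak_le_def)

lemma meet_weak_interval:
  assumes x: "x \<in> carrier (weak_interval n \<omega>)" and y: "y \<in> carrier (weak_interval n \<omega>)"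
    and \<omega>: "\<omega> permutes {1..n}"
    and h: "h permutes {1..n}" "NonInv n h = (NonInv n (inv x) \<union> NonInv n (inv y))\<^sup>+"
  shows "greatest (weak_interval n \<omega>) (inv h) (Lower (weak_interval n \<omega>) {x, y})"
proof -
  note ih = inv_permutes[OF h(1)]
  have px: "inv x permutes {1..n}" "inv y permutes {1..n}"
    using x y inv_permutes by (auto simp: carrier_weak_interval)
  have "NonInv n (inv x) \<subseteq> NonInv n h" "NonInv n (inv y) \<subseteq> NonInv n h" using h(2) by auto
  then have le: "Inv n h \<subseteq> Inv n (inv x)" "Inv n h \<subseteq> Inv n (inv y)"
    using Inv_subset_iff_NonInv[OF h(1) px(1)] Inv_subset_iff_NonInv[OF h(1) px(2)] by auto
  then have S: "inv h \<in> carrier (weak_interval n \<omega>)" using x ih by (auto simp: carrier_weak_interval)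
  show ?thesis
    unfolding greatest_def
  proof (intro conjI ballI)
    show "inv h \<in> Lower (weak_interval n \<omega>) {x, y}"
      using S le ih by (auto simp: Lower_def le_weak_interval)
  next
    fix z assume "z \<in> Lower (weak_interval n \<omega>) {x, y}"
    then have z: "z permutes {1..n}" "Inv n (inv z) \<subseteq> Inv n (inv x)" "Inv n (inv z) \<subseteq> Inv n (inv y)"
      using x y by (auto simp: Lower_def le_weak_interval carrier_weak_interval)
    note iz = inv_permutes[OF z(1)]
    have "NonInv n (inv x) \<union> NonInv n (inv y) \<subseteq> NonInv n (inv z)"
      using z Inv_subset_iff_NonInv[OF iz(1) px(1)] Inv_subset_iff_NonInv[OF iz(1) px(2)] by blast
    then have "NonInv n h \<subseteq> NonInv n (inv z)"
      unfolding h(2) by (rule trancl_subset_trans) (use NonInv_trans in blast)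
    then have "Inv n (inv z) \<subseteq> Inv n h" by (rule Inv_subset_iff_NonInv[OF iz(1) h(1), THEN iffD2])
    then show "z \<sqsubseteq>\<^bsub>weak_interval n \<omega>\<^esub> inv h" by (simp add: le_weak_interval ih(2))
  qed (auto simp: Lower_def)
qed

lemma join_weak_interval:
  assumes x: "x \<in> carrier (weak_interval n \<omega>)" and y: "y \<in> carrier (weak_interval n \<omega>)"
    and h: "h permutes {1..n}" "Inv n h = (Inv n (inv x) \<union> Inv n (inv y))\<^sup>+"
  shows "least (weak_interval n \<omega>) (inv h) (Upper (weak_interval n \<omega>) {x, y})"
proof -
  note ih = inv_permutes[OF h(1)]
  have min: "Inv n h \<subseteq> Inv n f" if "Inv n (inv x) \<subseteq> Inv n f" "Inv n (inv y) \<subseteq> Inv n f" for f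
    unfolding h(2) by (rule trancl_subset_trans) (use that Inv_trans in blast)+
  have S: "inv h \<in> carrier (weak_interval n \<omega>)"
    using x y ih min[of "inv \<omega>"] by (auto simp: carrier_weak_interval)
  show ?thesis
    unfolding least_def
  proof (intro conjI ballI)
    show "inv h \<in> Upper (weak_interval n \<omega>) {x, y}"
      using S h ih by (auto simp: Upper_def le_weak_interval)
  next
    fix z assume "z \<in> Upper (weak_interval n \<omega>) {x, y}"
    then show "inv h \<sqsubseteq>\<^bsub>weak_interval n \<omega>\<^esub> z"
      using min[of "inv z"] ih x y by (auto simp: Upper_def le_weak_interval)
  qed (auto simp: Upper_def)
qed

lemma lattice_weak_interval:
  assumes "\<omega> permutes {1..n}"
  shows "lattice (weak_interval n \<omega>)"
proof -
  interpret partial_order "weak_interval n \<omega>" by (rule partial_order_weak_interval)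
  show ?thesis
  proof
    fix x y assume xy: "x \<in> carrier (weak_interval n \<omega>)" "y \<in> carrier (weak_interval n \<omega>)"
    show "\<exists>s. least (weak_interval n \<omega>) s (Upper (weak_interval n \<omega>) {x, y})"
      using weak_join_exists join_weak_interval xy by metis
    show "\<exists>s. greatest (weak_interval n \<omega>) s (Lower (weak_interval n \<omega>) {x, y})"
      using weak_meet_exists meet_weak_interval xy assms by metis
  qed
qed

lemma acyclic_if_linear_extension:
  assumes "\<pi> \<in> linear_extensions n P"
  shows "\<not> pre_digraph.cycle (contact_graph n P) w"
proof
  let ?G = "contact_graph n P"
  assume "pre_digraph.cycle ?G w"
  then obtain u where w: "set w \<subseteq> arcs ?G" "pre_digraph.cas ?G u w u" "w \<noteq> []"
    by (auto simp: pre_digraph.cycle_def pre_digraph.awalk_def)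
  have "inv \<pi> u \<le> inv \<pi> v \<and> (w \<noteq> [] \<longrightarrow> inv \<pi> u < inv \<pi> v)"
    if "set w \<subseteq> arcs ?G" "pre_digraph.cas ?G u w v" for u v w
    using that
  proof (induction w arbitrary: u)
    case Nil
    then show ?case by (simp add: pre_digraph.cas.simps)
  next
    case (Cons e w)
    then have "inv \<pi> (tail ?G e) < inv \<pi> (head ?G e)"
      using assms by (auto simp: linear_extensions_def)
    then show ?case using Cons by (fastforce simp: pre_digraph.cas.simps)
  qed
  then show False using w by blast
qed

text \<open>Insertion supplies, for every element of the interval, a pipe dream having it as a
  linear extension, and this extension in turn excludes directed cycles.\<close>

lemma pipe_dream_congruence_iff:
  assumes \<omega>: "\<omega> permutes {1..n}"
  shows "(x, y) \<in> pipe_dream_congruence n \<omega> \<longleftrightarrow>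
    x \<in> carrier (weak_interval n \<omega>) \<and> y \<in> carrier (weak_interval n \<omega>) \<and>
    same_turning n (inv \<omega>) (inv x) (inv y)"
proof
  note q = inv_permutes[OF \<omega>]
  have S: "z \<in> carrier (weak_interval n \<omega>)" if "z \<in> linear_extensions n P" "P \<in> PD n \<omega>" for z P
  proof -
    have "z permutes {1..n}" using that by (simp add: linear_extensions_def)
    then show ?thesis
      using linear_extension_below[OF \<omega> that(2,1)] below_iff_Inv[OF q(1), of "inv z"] inv_permutes
      by (auto simp: carrier_weak_interval)
  qed
  assume "(x, y) \<in> pipe_dream_congruence n \<omega>"
  then obtain P where P: "P \<in> PD n \<omega>" "x \<in> linear_extensions n P" "y \<in> linear_extensions n P"
    by (auto simp: pipe_dream_congruence_def APD_def)
  then show "x \<in> carrier (weak_interval n \<omega>) \<and> y \<in> carrier (weak_interval n \<omega>) \<and>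
      same_turning n (inv \<omega>) (inv x) (inv y)"
    using S same_pipe_dream_iff[OF \<omega> P(1) P(1) P(2,3)] by blast
next
  note q = inv_permutes[OF \<omega>]
  have ex: "\<exists>P\<in>PD n \<omega>. z \<in> linear_extensions n P" if "z \<in> carrier (weak_interval n \<omega>)" for z
  proof -
    have z: "z permutes {1..n}" "Inv n (inv z) \<subseteq> Inv n (inv \<omega>)"
      using that by (auto simp: carrier_weak_interval)
    interpret insertion n \<omega> "inv z"
      using \<omega> inv_permutes[OF z(1)] z below_iff_Inv[OF q(1), of "inv z"] by unfold_locales auto
    show ?thesis using in_PD is_linear_extension inv_permutes[OF z(1)] by auto
  qed
  assume xy: "x \<in> carrier (weak_interval n \<omega>) \<and> y \<in> carrier (weak_interval n \<omega>) \<and>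
      same_turning n (inv \<omega>) (inv x) (inv y)"
  then obtain P Q where PQ: "P \<in> PD n \<omega>" "x \<in> linear_extensions n P"
    "Q \<in> PD n \<omega>" "y \<in> linear_extensions n Q"
    using ex by blast
  then have "P = Q" using same_pipe_dream_iff[OF \<omega>] xy by blast
  then show "(x, y) \<in> pipe_dream_congruence n \<omega>"
    using PQ acyclic_if_linear_extension by (auto simp: pipe_dream_congruence_def APD_def)
qed

lemma congruent_same_tests:
  assumes \<omega>: "\<omega> permutes {1..n}" and "(x, y) \<in> pipe_dream_congruence n \<omega>"
  shows "same_up n (inv \<omega>) (inv x) (inv y)" "same_down n (inv \<omega>) (inv x) (inv y)"
proof -
  obtain P where "P \<in> PD n \<omega>" "x \<in> linear_extensions n P" "y \<in> linear_extensions n P"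
    using assms(2) by (auto simp: pipe_dream_congruence_def APD_def)
  then show "same_up n (inv \<omega>) (inv x) (inv y)" "same_down n (inv \<omega>) (inv x) (inv y)"
    using linear_extensions_same_tests[OF \<omega>] by blast+
qed

text \<open>The up-tests of a meet are the conjunctions of those of its arguments, so congruent
  arguments yield meets with the same up-tests.\<close>

lemma congruence_meet:
  assumes \<omega>: "\<omega> permutes {1..n}"
    and xx: "(x, x') \<in> pipe_dream_congruence n \<omega>" and yy: "(y, y') \<in> pipe_dream_congruence n \<omega>"
  shows "(x \<sqinter>\<^bsub>weak_interval n \<omega>\<^esub> y, x' \<sqinter>\<^bsub>weak_interval n \<omega>\<^esub> y') \<in> pipe_dream_congruence n \<omega>"
proof -
  let ?L = "weak_interval n \<omega>"
  interpret lattice ?L using lattice_weak_interval[OF \<omega>] .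
  have S: "x \<in> carrier ?L" "x' \<in> carrier ?L" "y \<in> carrier ?L" "y' \<in> carrier ?L"
    using xx yy pipe_dream_congruence_iff[OF \<omega>] by auto
  have meet: "\<exists>h. h permutes {1..n} \<and> u \<sqinter>\<^bsub>?L\<^esub> v = inv h \<and> u \<sqinter>\<^bsub>?L\<^esub> v \<in> carrier ?L \<and>
      (\<forall>i j D. up_index n (inv \<omega>) i j D \<longrightarrow>
        (up_test h i j D \<longleftrightarrow> up_test (inv u) i j D \<and> up_test (inv v) i j D))"
    if uv: "u \<in> carrier ?L" "v \<in> carrier ?L" for u v
  proof -
    obtain h where h: "h permutes {1..n}" "NonInv n h = (NonInv n (inv u) \<union> NonInv n (inv v))\<^sup>+"
      by (rule weak_meet_exists)
    have gr: "greatest ?L (inv h) (Lower ?L {u, v})" using meet_weak_interval[OF uv \<omega> h] .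
    then have eq: "u \<sqinter>\<^bsub>?L\<^esub> v = inv h"
      using meetI[of u v "\<lambda>m. m = inv h"] greatest_unique uv by blast
    have "inv h \<in> Lower ?L {u, v}" using gr unfolding greatest_def by blast
    then have "Inv n h \<subseteq> Inv n (inv u)" "Inv n h \<subseteq> Inv n (inv v)"
      using uv inv_permutes[OF h(1)] by (auto simp: Lower_def le_weak_interval)
    then show ?thesis
      using h eq up_test_meet[OF h] up_test_mono uv by (intro exI[of _ h]) (metis meet_closed)
  qed
  obtain h where h: "h permutes {1..n}" "x \<sqinter>\<^bsub>?L\<^esub> y = inv h" "inv h \<in> carrier ?L"
    "\<And>i j D. up_index n (inv \<omega>) i j D \<Longrightarrow>
      up_test h i j D \<longleftrightarrow> up_test (inv x) i j D \<and> up_test (inv y) i j D"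
    using meet[OF S(1,3)] by auto
  obtain h' where h': "h' permutes {1..n}" "x' \<sqinter>\<^bsub>?L\<^esub> y' = inv h'" "inv h' \<in> carrier ?L"
    "\<And>i j D. up_index n (inv \<omega>) i j D \<Longrightarrow>
      up_test h' i j D \<longleftrightarrow> up_test (inv x') i j D \<and> up_test (inv y') i j D"
    using meet[OF S(2,4)] by auto
  have "same_up n (inv \<omega>) h h'"
    using h(4) h'(4) congruent_same_tests(1)[OF \<omega> xx] congruent_same_tests(1)[OF \<omega> yy]
    unfolding same_up_def by blast
  then have "same_turning n (inv \<omega>) h h'"
    using same_up_imp_same_turning[of "inv \<omega>" n h h'] h h' inv_permutes[OF \<omega>]
      inv_permutes[OF h(1)] inv_permutes[OF h'(1)] by (auto simp: carrier_weak_interval)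
  then show ?thesis
    using h h' inv_permutes[OF h(1)] inv_permutes[OF h'(1)] pipe_dream_congruence_iff[OF \<omega>] by simp
qed

lemma congruence_join:
  assumes \<omega>: "\<omega> permutes {1..n}"
    and xx: "(x, x') \<in> pipe_dream_congruence n \<omega>" and yy: "(y, y') \<in> pipe_dream_congruence n \<omega>"
  shows "(x \<squnion>\<^bsub>weak_interval n \<omega>\<^esub> y, x' \<squnion>\<^bsub>weak_interval n \<omega>\<^esub> y') \<in> pipe_dream_congruence n \<omega>"
proof -
  let ?L = "weak_interval n \<omega>"
  interpret lattice ?L using lattice_weak_interval[OF \<omega>] .
  have S: "x \<in> carrier ?L" "x' \<in> carrier ?L" "y \<in> carrier ?L" "y' \<in> carrier ?L"
    using xx yy pipe_dream_congruence_iff[OF \<omega>] by auto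
  have join: "\<exists>h. h permutes {1..n} \<and> u \<squnion>\<^bsub>?L\<^esub> v = inv h \<and> u \<squnion>\<^bsub>?L\<^esub> v \<in> carrier ?L \<and>
      (\<forall>i j D. down_index n (inv \<omega>) i j D \<longrightarrow>
        (down_test h i j D \<longleftrightarrow> down_test (inv u) i j D \<and> down_test (inv v) i j D))"
    if uv: "u \<in> carrier ?L" "v \<in> carrier ?L" for u v
  proof -
    obtain h where h: "h permutes {1..n}" "Inv n h = (Inv n (inv u) \<union> Inv n (inv v))\<^sup>+"
      by (rule weak_join_exists)
    have le: "least ?L (inv h) (Upper ?L {u, v})" using join_weak_interval[OF uv h] .
    then have eq: "u \<squnion>\<^bsub>?L\<^esub> v = inv h"
      using joinI[of u v "\<lambda>m. m = inv h"] least_unique uv by blast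
    have p: "inv u permutes {1..n}" "inv v permutes {1..n}"
      using uv inv_permutes by (auto simp: carrier_weak_interval)
    have "Inv n (inv u) \<subseteq> Inv n h" "Inv n (inv v) \<subseteq> Inv n h" using h(2) by auto
    then have "NonInv n h \<subseteq> NonInv n (inv u)" "NonInv n h \<subseteq> NonInv n (inv v)"
      using Inv_subset_iff_NonInv[OF p(1) h(1)] Inv_subset_iff_NonInv[OF p(2) h(1)] by auto
    then show ?thesis
      using h eq down_test_join[OF h] down_test_antimono uv
      by (intro exI[of _ h]) (metis join_closed)
  qed
  obtain h where h: "h permutes {1..n}" "x \<squnion>\<^bsub>?L\<^esub> y = inv h" "inv h \<in> carrier ?L"
    "\<And>i j D. down_index n (inv \<omega>) i j D \<Longrightarrow>
      down_test h i j D \<longleftrightarrow> down_test (inv x) i j D \<and> down_test (inv y) i j D"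
    using join[OF S(1,3)] by auto
  obtain h' where h': "h' permutes {1..n}" "x' \<squnion>\<^bsub>?L\<^esub> y' = inv h'" "inv h' \<in> carrier ?L"
    "\<And>i j D. down_index n (inv \<omega>) i j D \<Longrightarrow>
      down_test h' i j D \<longleftrightarrow> down_test (inv x') i j D \<and> down_test (inv y') i j D"
    using join[OF S(2,4)] by auto
  have "same_down n (inv \<omega>) h h'"
    using h(4) h'(4) congruent_same_tests(2)[OF \<omega> xx] congruent_same_tests(2)[OF \<omega> yy]
    unfolding same_down_def by blast
  then have "same_turning n (inv \<omega>) h h'"
    using same_down_imp_same_turning[of "inv \<omega>" n h h'] h h' inv_permutes[OF \<omega>]
      inv_permutes[OF h(1)] inv_permutes[OF h'(1)] by (auto simp: carrier_weak_interval)
  then show ?thesis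
    using h h' inv_permutes[OF h(1)] inv_permutes[OF h'(1)] pipe_dream_congruence_iff[OF \<omega>] by simp
qed

theorem theorem3p10:
  fixes n :: nat and \<omega> :: "nat \<Rightarrow> nat"
  assumes "n \<ge> 1"
    and "\<omega> permutes {1..n}"
  shows "lattice_congruence (weak_interval n \<omega>) (pipe_dream_congruence n \<omega>)"
  unfolding lattice_congruence_def
proof (intro conjI allI impI)
  show "lattice (weak_interval n \<omega>)" using lattice_weak_interval assms by blast
  note iff = pipe_dream_congruence_iff[OF assms(2)]
  have "pipe_dream_congruence n \<omega> \<subseteq> carrier (weak_interval n \<omega>) \<times> carrier (weak_interval n \<omega>)"
    unfolding subset_iff split_paired_All iff by blast
  moreover have "refl_on (carrier (weak_interval n \<omega>)) (pipe_dream_congruence n \<omega>)"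
    by (rule refl_onI) (use calculation iff same_turning_refl in blast)+
  moreover have "sym (pipe_dream_congruence n \<omega>)"
    by (rule symI) (use iff same_turning_sym in blast)
  moreover have "trans (pipe_dream_congruence n \<omega>)"
    by (rule transI) (use iff same_turning_trans in blast)
  ultimately show "equiv (carrier (weak_interval n \<omega>)) (pipe_dream_congruence n \<omega>)"
    by (intro equivI)
qed (use congruence_meet congruence_join assms(2) in blast)+

end
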